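(* Let $K$ be a simplicial complex which is a near cone with respect to a vertex $v$. Then $$\Delta(K)=\{\{1\}\cup(T+1):\ T\in\Delta(\mathrm{lk}(v,K))\}\ \cup\ B,$$ where $B=\{S\in \Delta(K): 1 \notin S\}$ and $T+1=\{t+1:t\in T\}$.
   Context: Simplicial complexes are finite and contain the empty set. For a complex $K$, $K_0$ denotes its vertex set. $[n]=\{1,\dots,n\}$. A complex $K$ is a near cone with respect to a vertex $v$ if for every $S\in K$ and $j\in S$ also $(S\cup\{v\})\setminus\{j\}\in K$. The link is $\mathrm{lk}(v,K)=\{T\in K: v\notin T,\ T\cup\{v\}\in K\}$. Lexicographic order: for sets $S\ne T$ of positive integers of equal size, $S<_L T$ iff $\min(S\triangle T)\in S$. Algebraic shifting (exterior): let $K$ be a simplicial complex with vertex set contained in $[n]$ (label the vertices by positive integers if necessary). Let $V$ be a real vector space with basis $e_1,\dots,e_n$, and let $f_i=\sum_{j=1}^n\alpha_{ij}e_j$, $1\le i\le n$, where the $n^2$ real numbers $\alpha_{ij}$ are algebraically independent over $\mathbb{Q}$. For $S=\{s_1<\dots<s_k\}\subseteq[n]$ put $e_S=e_{s_1}\wedge\dots\wedge e_{s_k}$, $f_S=f_{s_1}\wedge\dots\wedge f_{s_k}$ in $\bigwedge V$, and let $\tilde f_S$ be the image of $f_S$ in $(\bigwedge V)/(e_T: T\subseteq[n],\,T\notin K)$. Then $$\Delta(K)=\{S\subseteq[n]:\ \tilde f_S\notin \mathrm{span}\{\tilde f_{S'}: |S'|=|S|,\ S'<_L S\}\}.$$ $\Delta(K)$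 does not depend on the choice of the generic matrix, of $n$, or of the vertex labelling; it is a simplicial complex with vertex set $\{1,\dots,|K_0|\}$. *)

theory Defs
  imports Complex_Main "HOL-Library.Poly_Mapping"
begin

section \<open>Simplicial complexes\<close>

definition simplicial_complex :: "'a set set \<Rightarrow> bool" where
  "simplicial_complex K \<longleftrightarrow> finite K \<and> {} \<in> K \<and> (\<forall>S\<in>K. finite S) \<and> (\<forall>S\<in>K. \<forall>T\<subseteq>S. T \<in> K)"

definition vertices :: "'a set set \<Rightarrow> 'a set" where
  "vertices K = {v. {v} \<in> K}"

definition near_cone :: "'a \<Rightarrow> 'a set set \<Rightarrow> bool" where
  "near_cone v K \<longleftrightarrow> v \<in> vertices K \<and> (\<forall>S\<in>K. \<forall>j\<in>S. (S \<union> {v}) - {j} \<in> K)"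

definition link :: "'a \<Rightarrow> 'a set set \<Rightarrow> 'a set set" where
  "link v K = {T \<in> K. v \<notin> T \<and> T \<union> {v} \<in> K}"


section \<open>The exterior algebra\<close>

text \<open>
  An element of the exterior algebra of the real vector space with basis \<open>e\<^sub>0, e\<^sub>1, \<dots>\<close> is given by
  its coordinates with respect to the basis \<open>e\<^sub>S\<close>, \<open>S\<close> a finite set of natural numbers.
  The exterior algebra of the span of \<open>e\<^sub>1, \<dots>, e\<^sub>n\<close> is the subalgebra \<open>exterior_upto n\<close> below.
\<close>

typedef exterior = "{x :: nat set \<Rightarrow> real. finite {S. x S \<noteq> 0} \<and> (\<forall>S. infinite S \<longrightarrow> x S = 0)}"
  morphisms coord Abs_exterior
  by (rule exI[of _ "\<lambda>_. 0"]) simp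

setup_lifting type_definition_exterior

text \<open>
  \<open>e\<^sub>S \<and> e\<^sub>T = (-1)\<^bsup>inversions S T\<^esup> e\<^bsub>S \<union> T\<^esub>\<close> for disjoint \<open>S\<close> and \<open>T\<close>, and \<open>e\<^sub>S \<and> e\<^sub>T = 0\<close> otherwise.
\<close>

definition inversions :: "nat set \<Rightarrow> nat set \<Rightarrow> nat" where
  "inversions S T = card {(s, t). s \<in> S \<and> t \<in> T \<and> t < s}"

lemma inversions_eq_sum:
  assumes "finite S" "finite T"
  shows "inversions S T = (\<Sum>s\<in>S. \<Sum>t\<in>T. if t < s then 1 else 0)"
proof -
  have "{(s, t). s \<in> S \<and> t \<in> T \<and> t < s} = (SIGMA s:S. {t \<in> T. t < s})" by auto
  then show ?thesis
    using assms by (simp add: inversions_def card_SigmaI sum.If_cases Int_def)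
qed

lemma inversions_Un:
  assumes "finite S" "finite S'" "finite T"
  shows "S \<inter> S' = {} \<Longrightarrow> inversions (S \<union> S') T = inversions S T + inversions S' T"
    and "S \<inter> S' = {} \<Longrightarrow> inversions T (S \<union> S') = inversions T S + inversions T S'"
  using assms by (simp_all add: inversions_eq_sum sum.union_disjoint sum.distrib)

lemma inversions_empty [simp]: "inversions {} T = 0" "inversions S {} = 0"
  by (simp_all add: inversions_def)

instantiation exterior :: real_algebra_1
begin

lift_definition zero_exterior :: exterior is "\<lambda>_. 0" by simp

lift_definition one_exterior :: exterior is "\<lambda>S. if S = {} then 1 else 0" by auto

lift_definition plus_exterior :: "exterior \<Rightarrow> exterior \<Rightarrow> exterior" is "\<lambda>x y S. x S + y S"
proof -
  fix x y :: "nat set \<Rightarrow> real"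
  assume *: "finite {S. x S \<noteq> 0} \<and> (\<forall>S. infinite S \<longrightarrow> x S = 0)"
    "finite {S. y S \<noteq> 0} \<and> (\<forall>S. infinite S \<longrightarrow> y S = 0)"
  have "{S. x S + y S \<noteq> 0} \<subseteq> {S. x S \<noteq> 0} \<union> {S. y S \<noteq> 0}" by auto
  then show "finite {S. x S + y S \<noteq> 0} \<and> (\<forall>S. infinite S \<longrightarrow> x S + y S = 0)"
    using * by (auto intro: finite_subset)
qed

lift_definition uminus_exterior :: "exterior \<Rightarrow> exterior" is "\<lambda>x S. - x S" by simp

lift_definition minus_exterior :: "exterior \<Rightarrow> exterior \<Rightarrow> exterior" is "\<lambda>x y S. x S - y S"
proof -
  fix x y :: "nat set \<Rightarrow> real"
  assume *: "finite {S. x S \<noteq> 0} \<and> (\<forall>S. infinite S \<longrightarrow> x S = 0)"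
    "finite {S. y S \<noteq> 0} \<and> (\<forall>S. infinite S \<longrightarrow> y S = 0)"
  have "{S. x S - y S \<noteq> 0} \<subseteq> {S. x S \<noteq> 0} \<union> {S. y S \<noteq> 0}" by auto
  then show "finite {S. x S - y S \<noteq> 0} \<and> (\<forall>S. infinite S \<longrightarrow> x S - y S = 0)"
    using * by (auto intro: finite_subset)
qed

lift_definition scaleR_exterior :: "real \<Rightarrow> exterior \<Rightarrow> exterior" is "\<lambda>c x S. c * x S"
  by (auto elim: rev_finite_subset)

lift_definition times_exterior :: "exterior \<Rightarrow> exterior \<Rightarrow> exterior"
  is "\<lambda>x y U. \<Sum>S\<in>Pow U. (-1) ^ inversions S (U - S) * x S * y (U - S)"
proof -
  fix x y :: "nat set \<Rightarrow> real"
  assume *: "finite {S. x S \<noteq> 0} \<and> (\<forall>S. infinite S \<longrightarrow> x S = 0)"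
    "finite {S. y S \<noteq> 0} \<and> (\<forall>S. infinite S \<longrightarrow> y S = 0)"
  let ?z = "\<lambda>U. \<Sum>S\<in>Pow U. (-1) ^ inversions S (U - S) * x S * y (U - S)"
  have "{U. ?z U \<noteq> 0} \<subseteq> (\<lambda>(S, T). S \<union> T) ` ({S. x S \<noteq> 0} \<times> {S. y S \<noteq> 0})"
  proof
    fix U assume "U \<in> {U. ?z U \<noteq> 0}"
    then have "?z U \<noteq> 0" by simp
    then obtain S where "S \<in> Pow U" "(-1) ^ inversions S (U - S) * x S * y (U - S) \<noteq> 0"
      by (rule sum.not_neutral_contains_not_neutral)
    then have "S \<subseteq> U" "x S \<noteq> 0" "y (U - S) \<noteq> 0" by auto
    then show "U \<in> (\<lambda>(S, T). S \<union> T) ` ({S. x S \<noteq> 0} \<times> {S. y S \<noteq> 0})"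
      by (intro image_eqI[of _ _ "(S, U - S)"]) auto
  qed
  then show "finite {U. ?z U \<noteq> 0} \<and> (\<forall>U. infinite U \<longrightarrow> ?z U = 0)"
    using * by (auto intro: finite_subset)
qed

instance
proof
  fix x y z :: exterior and a b :: real
  show "x * y * z = x * (y * z)"
  proof (transfer, rule ext)
    fix x y z :: "nat set \<Rightarrow> real" and U :: "nat set"
    assume z: "finite {S. z S \<noteq> 0} \<and> (\<forall>S. infinite S \<longrightarrow> z S = 0)"
    show "(\<Sum>A\<in>Pow U. (-1) ^ inversions A (U - A) *
            (\<Sum>B\<in>Pow A. (-1) ^ inversions B (A - B) * x B * y (A - B)) * z (U - A)) =
          (\<Sum>B\<in>Pow U. (-1) ^ inversions B (U - B) * x B *
            (\<Sum>C\<in>Pow (U - B). (-1) ^ inversions C (U - B - C) * y C * z (U - B - C)))"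
      (is "?L = ?R")
    proof (cases "finite U")
      case False
      then show ?thesis by simp
    next
      case U: True
      have "?L = (\<Sum>(A, B)\<in>(SIGMA A:Pow U. Pow A). (-1) ^ inversions A (U - A) *
          ((-1) ^ inversions B (A - B) * x B * y (A - B)) * z (U - A))"
        using U by (subst sum.Sigma[symmetric])
          (auto simp: sum_distrib_left sum_distrib_right finite_subset intro!: sum.cong)
      also have "\<dots> = (\<Sum>(B, C)\<in>(SIGMA B:Pow U. Pow (U - B)). (-1) ^ inversions B (U - B) * x B *
          ((-1) ^ inversions C (U - B - C) * y C * z (U - B - C)))"
      proof (rule sum.reindex_bij_witness[of _ "\<lambda>(B, C). (B \<union> C, B)" "\<lambda>(A, B). (B, A - B)"])
        fix p assume "p \<in> (SIGMA A:Pow U. Pow A)"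
        then obtain A B where p: "p = (A, B)" "B \<subseteq> A" "A \<subseteq> U" by auto
        define C where "C = A - B"
        define D where "D = U - A"
        have fin: "finite B" "finite C" "finite D"
          using U p by (auto simp: C_def D_def intro: finite_subset)
        have eqs: "A = B \<union> C" "U - A = D" "A - B = C" "U - B = C \<union> D" "U - B - C = D"
          "C \<union> D - C = D"
          using p by (auto simp: C_def D_def)
        have disj: "B \<inter> C = {}" "C \<inter> D = {}" by (auto simp: C_def D_def)
        show "(case (case p of (A, B) \<Rightarrow> (B, A - B)) of (B, C) \<Rightarrow>
              (-1) ^ inversions B (U - B) * x B * ((-1) ^ inversions C (U - B - C) * y C * z (U - B - C))) =
            (case p of (A, B) \<Rightarrow> (-1) ^ inversions A (U - A) *
              ((-1) ^ inversions B (A - B) * x B * y (A - B)) * z (U - A))"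
          unfolding p(1) prod.case eqs(3,5) unfolding eqs(2,4) unfolding eqs(1)
          by (simp add: inversions_Un fin disj power_add)
      qed auto
      also have "\<dots> = ?R"
        using U by (subst sum.Sigma[symmetric]) (auto simp: sum_distrib_left finite_subset)
      finally show ?thesis .
    qed
  qed
  show "1 * x = x"
  proof (transfer, rule ext)
    fix x :: "nat set \<Rightarrow> real" and U :: "nat set"
    assume x: "finite {S. x S \<noteq> 0} \<and> (\<forall>S. infinite S \<longrightarrow> x S = 0)"
    have "(\<Sum>S\<in>Pow U. (-1) ^ inversions S (U - S) * (if S = {} then 1 else 0) * x (U - S)) =
        (\<Sum>S\<in>Pow U. if S = {} then x U else 0)"
      by (rule sum.cong) auto
    then show "(\<Sum>S\<in>Pow U. (-1) ^ inversions S (U - S) * (if S = {} then 1 else 0) * x (U - S)) = x U"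
      using x by (cases "finite U") auto
  qed
  show "x * 1 = x"
  proof (transfer, rule ext)
    fix x :: "nat set \<Rightarrow> real" and U :: "nat set"
    assume x: "finite {S. x S \<noteq> 0} \<and> (\<forall>S. infinite S \<longrightarrow> x S = 0)"
    have "(\<Sum>S\<in>Pow U. (-1) ^ inversions S (U - S) * x S * (if U - S = {} then 1 else 0)) =
        (\<Sum>S\<in>Pow U. if S = U then x U else 0)"
      by (rule sum.cong) auto
    then show "(\<Sum>S\<in>Pow U. (-1) ^ inversions S (U - S) * x S * (if U - S = {} then 1 else 0)) = x U"
      using x by (cases "finite U") auto
  qed
  show "(x + y) * z = x * z + y * z"
    by (transfer, rule ext) (simp add: algebra_simps sum.distrib)
  show "x * (y + z) = x * y + x * z"
    by (transfer, rule ext) (simp add: algebra_simps sum.distrib)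
  show "a *\<^sub>R x * y = a *\<^sub>R (x * y)"
    by (transfer, rule ext) (simp add: sum_distrib_left mult_ac)
  show "x * a *\<^sub>R y = a *\<^sub>R (x * y)"
    by (transfer, rule ext) (simp add: sum_distrib_left mult_ac)
  show "(0 :: exterior) \<noteq> 1"
    by transfer (auto dest: fun_cong[of _ _ "{}"])
qed (transfer; auto simp: algebra_simps)+

end

lift_definition basis_vec :: "nat \<Rightarrow> exterior" is "\<lambda>i S. if S = {i} then 1 else 0"
  by auto

text \<open>\<open>g\<^sub>S = g\<^bsub>s\<^sub>1\<^esub> \<and> \<dots> \<and> g\<^bsub>s\<^sub>k\<^esub>\<close> for \<open>S = {s\<^sub>1 < \<dots> < s\<^sub>k}\<close>; multiplication in \<^typ>\<open>exterior\<close> is the wedge product.\<close>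

definition wedge :: "(nat \<Rightarrow> exterior) \<Rightarrow> nat set \<Rightarrow> exterior" where
  "wedge g S = prod_list (map g (sorted_list_of_set S))"

lemma coord_wedge_basis_vec:
  assumes "finite S"
  shows "coord (wedge basis_vec S) T = (if T = S then 1 else 0)"
  using assms
proof (induction S arbitrary: T rule: finite_linorder_min_induct)
  case empty
  then show ?case by (simp add: wedge_def one_exterior.rep_eq)
next
  case (insert b A)
  have "b \<notin> A" using insert.hyps by auto
  have inv: "inversions {b} A = 0"
    using insert.hyps by (auto simp: inversions_eq_sum)
  have "coord (wedge basis_vec (insert b A)) T = coord (basis_vec b * wedge basis_vec A) T"
    using insert.hyps \<open>b \<notin> A\<close> by (simp add: wedge_def insort_is_Cons less_imp_le)
  also have "\<dots> = (\<Sum>S\<in>Pow T. if S = {b} then (if T - {b} = A then 1 else 0) else 0)"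
    unfolding times_exterior.rep_eq basis_vec.rep_eq insert.IH
    by (rule sum.cong) (auto simp: inv)
  also have "\<dots> = (if T = insert b A then 1 else 0)"
    using \<open>b \<notin> A\<close> \<open>finite A\<close> by (cases "finite T") auto
  finally show ?case .
qed

definition exterior_upto :: "nat \<Rightarrow> exterior set" where
  "exterior_upto n = span (wedge basis_vec ` Pow {1..n})"


section \<open>Algebraic independence over the rationals\<close>

text \<open>
  Multivariate polynomials over the rationals in variables indexed by \<^typ>\<open>'i\<close> are elements of
  \<^typ>\<open>('i \<Rightarrow>\<^sub>0 nat) \<Rightarrow>\<^sub>0 rat\<close>, mapping exponent vectors to coefficients.
\<close>

definition poly_vars :: "(('i \<Rightarrow>\<^sub>0 nat) \<Rightarrow>\<^sub>0 rat) \<Rightarrow> 'i set" where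
  "poly_vars p = (\<Union>m\<in>Poly_Mapping.keys p. Poly_Mapping.keys m)"

definition poly_eval :: "('i \<Rightarrow> real) \<Rightarrow> (('i \<Rightarrow>\<^sub>0 nat) \<Rightarrow>\<^sub>0 rat) \<Rightarrow> real" where
  "poly_eval x p = (\<Sum>m\<in>Poly_Mapping.keys p. of_rat (Poly_Mapping.lookup p m) *
     (\<Prod>i\<in>Poly_Mapping.keys m. x i ^ Poly_Mapping.lookup m i))"

definition algebraically_independent :: "'i set \<Rightarrow> ('i \<Rightarrow> real) \<Rightarrow> bool" where
  "algebraically_independent I x \<longleftrightarrow> (\<forall>p. poly_vars p \<subseteq> I \<and> poly_eval x p = 0 \<longrightarrow> p = 0)"


section \<open>Exterior algebraic shifting\<close>

definition generic :: "nat \<Rightarrow> (nat \<Rightarrow> nat \<Rightarrow> real) \<Rightarrow> bool" where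
  "generic n \<alpha> \<longleftrightarrow> algebraically_independent ({1..n} \<times> {1..n}) (\<lambda>(i, j). \<alpha> i j)"

definition lex_less :: "nat set \<Rightarrow> nat set \<Rightarrow> bool" where
  "lex_less S T \<longleftrightarrow> S \<noteq> T \<and> card S = card T \<and> Min ((S - T) \<union> (T - S)) \<in> S"

definition generic_vec :: "nat \<Rightarrow> (nat \<Rightarrow> nat \<Rightarrow> real) \<Rightarrow> nat \<Rightarrow> exterior" where
  "generic_vec n \<alpha> i = (\<Sum>j = 1..n. \<alpha> i j *\<^sub>R basis_vec j)"

text \<open>The two-sided ideal of \<open>exterior_upto n\<close> generated by the \<open>e\<^sub>T\<close> with \<open>T\<close> not in \<open>K\<close>.\<close>

definition nonface_ideal :: "nat \<Rightarrow> nat set set \<Rightarrow> exterior set" where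
  "nonface_ideal n K = span {x * wedge basis_vec T * y | x T y.
     x \<in> exterior_upto n \<and> T \<subseteq> {1..n} \<and> T \<notin> K \<and> y \<in> exterior_upto n}"

definition residue_class :: "exterior set \<Rightarrow> exterior \<Rightarrow> exterior set" where
  "residue_class I x = {y. y - x \<in> I}"

text \<open>
  Shifting of a complex on a subset of \<open>{1..n}\<close>. The span of the classes of the earlier \<open>f\<^bsub>S'\<^esub>\<close> in
  the quotient is the image under the (linear) quotient map of the span of these \<open>f\<^bsub>S'\<^esub>\<close>.
\<close>

definition shift_labelled :: "nat \<Rightarrow> (nat \<Rightarrow> nat \<Rightarrow> real) \<Rightarrow> nat set set \<Rightarrow> nat set set" where
  "shift_labelled n \<alpha> K = {S. S \<subseteq> {1..n} \<and>
     residue_class (nonface_ideal n K) (wedge (generic_vec n \<alpha>) S) \<notin>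
       residue_class (nonface_ideal n K) `
         span {wedge (generic_vec n \<alpha>) S' | S'. S' \<subseteq> {1..n} \<and> card S' = card S \<and> lex_less S' S}}"

definition labelling :: "nat \<Rightarrow> ('a \<Rightarrow> nat) \<Rightarrow> 'a set set \<Rightarrow> bool" where
  "labelling n \<phi> K \<longleftrightarrow> inj_on \<phi> (vertices K) \<and> \<phi> ` vertices K \<subseteq> {1..n}"

text \<open>
  The shifted complex, with all choices entering its definition explicit: an ambient \<open>n\<close>,
  a generic matrix \<open>\<alpha>\<close> and a labelling \<open>\<phi>\<close> of the vertices by elements of \<open>{1..n}\<close>.
\<close>

definition algebraic_shift :: "nat \<Rightarrow> (nat \<Rightarrow> nat \<Rightarrow> real) \<Rightarrow> ('a \<Rightarrow> nat) \<Rightarrow> 'a set set \<Rightarrow> nat set set" where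
  "algebraic_shift n \<alpha> \<phi> K = shift_labelled n \<alpha> ((`) \<phi> ` K)"

end

theory Submission
  imports Defs
begin

text \<open>
  Let \<open>w\<close> be the label of \<open>v\<close>. The sets below \<open>{1} \<union> T\<close> in the lexicographic order all contain \<open>1\<close>,
  so the question is about linear dependencies among the \<open>f\<^sub>1 \<and> f\<^sub>T\<close>. Each \<open>f\<^sub>i\<close> with \<open>i \<ge> 2\<close> may be replaced
  by \<open>h\<^sub>i = \<alpha>\<^bsub>1w\<^esub> f\<^sub>i - \<alpha>\<^bsub>iw\<^esub> f\<^sub>1\<close>, which does not involve \<open>e\<^sub>w\<close>. For \<open>z\<close> not involving \<open>e\<^sub>w\<close> the near cone
  property says precisely that \<open>f\<^sub>1 \<and> z\<close> vanishes on \<open>K\<close> iff \<open>z\<close> vanishes on the link. Hence \<open>{1} \<union> (T + 1)\<close>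
  is in the shifting of \<open>K\<close> iff \<open>T\<close> is in the shifting of the link with respect to the rows \<open>h\<^sub>i\<close>.

  The matrix of the \<open>h\<^sub>i\<close> need not be shown algebraically independent: it is enough that a polynomial vanishing
  at it vanishes identically, and this holds since every matrix arises from some \<open>\<alpha>\<close> with
  \<open>\<alpha>\<^bsub>1w\<^esub> = 1\<close> and \<open>\<alpha>\<^bsub>iw\<^esub> = 0\<close> for \<open>i \<ge> 2\<close>. By Gaussian elimination, linear dependencies with polynomial coefficients are the
  same at any two such points, and the rows beyond the number of vertices never contribute, so the shifting of
  the link may be computed from \<open>\<beta>\<close> and \<open>\<psi>\<close> as well.
\<close>

section \<open>The exterior algebra in coordinates\<close>

lemmas coord_simps = zero_exterior.rep_eq one_exterior.rep_eq plus_exterior.rep_eq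
  minus_exterior.rep_eq uminus_exterior.rep_eq scaleR_exterior.rep_eq

lemma coord_infinite: "infinite S \<Longrightarrow> coord x S = 0"
  using coord[of x] by simp

lemma exterior_eqI: "(\<And>S. coord x S = coord y S) \<Longrightarrow> x = y"
  by (simp add: coord_inject[symmetric] ext)

lemma coord_sum: "coord (\<Sum>i\<in>A. x i) S = (\<Sum>i\<in>A. coord (x i) S)"
  by (induction A rule: infinite_finite_induct) (simp_all add: coord_simps)

lemma exterior_expansion:
  assumes "finite A" "\<And>S. coord x S \<noteq> 0 \<Longrightarrow> S \<in> A"
  shows "x = (\<Sum>S\<in>A. coord x S *\<^sub>R wedge basis_vec S)"
proof (rule exterior_eqI)
  fix T
  have "coord (\<Sum>S\<in>A. coord x S *\<^sub>R wedge basis_vec S) T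
      = (\<Sum>S\<in>A. if S = T then coord x T else 0)"
    unfolding coord_sum scaleR_exterior.rep_eq
  proof (rule sum.cong)
    fix S assume "S \<in> A"
    show "coord x S * coord (wedge basis_vec S) T = (if S = T then coord x T else 0)"
      by (cases "finite S") (auto simp: coord_wedge_basis_vec coord_infinite)
  qed simp
  also have "\<dots> = coord x T"
    using assms by auto
  finally show "coord x T = coord (\<Sum>S\<in>A. coord x S *\<^sub>R wedge basis_vec S) T" ..
qed

text \<open>Only the summand with left factor \<open>{j}\<close> survives in the product, and its
  sign counts the elements of \<open>T\<close> that \<open>j\<close> has to pass.\<close>

lemma coord_basis_vec_times:
  "coord (basis_vec j * x) T =
    (if j \<in> T then (-1) ^ card {t \<in> T. t < j} * coord x (T - {j}) else 0)"
proof (cases "finite T")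
  case False
  then show ?thesis by (simp add: coord_infinite)
next
  case True
  have "inversions {j} (T - {j}) = card {t \<in> T. t < j}"
    using True by (simp add: inversions_eq_sum sum.If_cases Int_def)
      (rule arg_cong[of _ _ card], auto)
  moreover have "coord (basis_vec j * x) T =
      (\<Sum>S\<in>Pow T. if S = {j} then (-1) ^ inversions {j} (T - {j}) * coord x (T - {j}) else 0)"
    unfolding times_exterior.rep_eq basis_vec.rep_eq by (rule sum.cong) auto
  ultimately show ?thesis
    using True by auto
qed

lemma coord_times_nonzeroD:
  assumes "coord (x * y) U \<noteq> 0"
  obtains S where "S \<subseteq> U" "coord x S \<noteq> 0" "coord y (U - S) \<noteq> 0"
proof -
  have "(\<Sum>S\<in>Pow U. (-1) ^ inversions S (U - S) * coord x S * coord y (U - S)) \<noteq> 0"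
    using assms by (simp add: times_exterior.rep_eq)
  then obtain S where "S \<in> Pow U" "(-1) ^ inversions S (U - S) * coord x S * coord y (U - S) \<noteq> 0"
    by (rule sum.not_neutral_contains_not_neutral)
  then show ?thesis using that by auto
qed

lemma basis_vec_anticommute: "basis_vec i * basis_vec j = - (basis_vec j * basis_vec i)"
proof (rule exterior_eqI)
  fix T
  show "coord (basis_vec i * basis_vec j) T = coord (- (basis_vec j * basis_vec i)) T"
  proof (cases "i \<noteq> j \<and> T = {i, j}")
    case True
    then have T: "T = {i, j}" "i \<noteq> j" by auto
    have "{t \<in> T. t < i} = (if j < i then {j} else {})"
      "{t \<in> T. t < j} = (if i < j then {i} else {})" "T - {i} = {j}" "T - {j} = {i}"
      using T by auto
    then show ?thesis
      using T by (auto simp: coord_basis_vec_times coord_simps basis_vec.rep_eq)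
  next
    case False
    then have "\<not> (i \<in> T \<and> T - {i} = {j})" "\<not> (j \<in> T \<and> T - {j} = {i})" by auto
    then show ?thesis
      by (auto simp: coord_basis_vec_times coord_simps basis_vec.rep_eq)
  qed
qed

section \<open>Wedge products of pairwise anticommuting vectors\<close>

lemma wedge_insert_min:
  assumes "finite S" "\<And>s. s \<in> S \<Longrightarrow> b < s"
  shows "wedge g (insert b S) = g b * wedge g S"
proof -
  have "b \<notin> S" using assms(2) by blast
  then show ?thesis
    using assms by (simp add: wedge_def insort_is_Cons less_imp_le)
qed

lemma wedge_empty [simp]: "wedge g {} = 1"
  by (simp add: wedge_def)

text \<open>The case \<open>i = j\<close> is included; over the reals it already forces every square
  to vanish.\<close>

definition anticommuting :: "('i \<Rightarrow> exterior) \<Rightarrow> bool" where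
  "anticommuting h \<longleftrightarrow> (\<forall>i j. h i * h j = - (h j * h i))"

lemma anticommuting_square:
  assumes "anticommuting h"
  shows "h i * h i = 0"
proof -
  have "h i * h i = - (h i * h i)" using assms unfolding anticommuting_def by blast
  then have "2 *\<^sub>R (h i * h i) = 0"
    by (metis add.right_inverse scaleR_2)
  then show ?thesis by simp
qed

text \<open>Moving \<open>h j\<close> past each smaller factor changes the sign once; if
  \<open>j\<close> lies in \<open>T\<close>, it meets its own copy and the product vanishes.\<close>

lemma times_wedge:
  assumes "anticommuting h" "finite T"
  shows "h j * wedge h T =
    (if j \<in> T then 0 else (-1) ^ card {t \<in> T. t < j} *\<^sub>R wedge h (insert j T))"
  using assms(2)
proof (induction rule: finite_linorder_min_induct)
  case empty
  then show ?case using wedge_insert_min[of "{}" j h] by simp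
next
  case (insert b A)
  have w: "wedge h (insert b A) = h b * wedge h A"
    using insert.hyps by (intro wedge_insert_min) auto
  consider "j < b" | "j = b" | "b < j" by linarith
  then show ?case
  proof cases
    case 1
    then have "{t \<in> insert b A. t < j} = {}" and "j \<notin> insert b A"
      using insert.hyps by auto
    moreover have "wedge h (insert j (insert b A)) = h j * wedge h (insert b A)"
      using 1 insert.hyps by (intro wedge_insert_min) auto
    ultimately show ?thesis by (simp only: card.empty power_0 scaleR_one if_False)
  next
    case 2
    then show ?thesis
      using w anticommuting_square[OF assms(1), of b] by (simp add: mult.assoc[symmetric])
  next
    case 3
    have "h j * wedge h (insert b A) = - (h b * (h j * wedge h A))"
    proof -
      have "h j * wedge h (insert b A) = (h j * h b) * wedge h A"
        by (simp only: w mult.assoc)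
      also have "h j * h b = - (h b * h j)"
        using assms(1) unfolding anticommuting_def by blast
      finally show ?thesis by (simp add: mult.assoc)
    qed
    moreover have "wedge h (insert b (insert j A)) = h b * wedge h (insert j A)"
      using 3 insert.hyps by (intro wedge_insert_min) auto
    moreover have "{t \<in> insert b A. t < j} = insert b {t \<in> A. t < j}"
      using 3 by auto
    moreover have "b \<notin> A" using insert.hyps by auto
    ultimately show ?thesis
      using insert 3 by (auto simp: insert_commute)
  qed
qed

definition row_vec :: "nat set \<Rightarrow> ('i \<Rightarrow> nat \<Rightarrow> real) \<Rightarrow> 'i \<Rightarrow> exterior" where
  "row_vec X a i = (\<Sum>j\<in>X. a i j *\<^sub>R basis_vec j)"

lemma generic_vec_eq_row_vec: "generic_vec n \<alpha> = row_vec {1..n} \<alpha>"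
  by (simp add: generic_vec_def row_vec_def fun_eq_iff)

lemma anticommuting_row_vec: "anticommuting (row_vec X a)"
proof -
  have "row_vec X a i * row_vec X a j = - (row_vec X a j * row_vec X a i)" for i j
  proof -
    have "row_vec X a i * row_vec X a j
        = (\<Sum>k\<in>X. \<Sum>l\<in>X. a i k *\<^sub>R basis_vec k * a j l *\<^sub>R basis_vec l)"
      by (simp only: row_vec_def sum_product)
    also have "\<dots> = (\<Sum>l\<in>X. \<Sum>k\<in>X. - (a j l *\<^sub>R basis_vec l * a i k *\<^sub>R basis_vec k))"
    proof (subst sum.swap, intro sum.cong)
      fix k l
      show "a i k *\<^sub>R basis_vec k * a j l *\<^sub>R basis_vec l =
          - (a j l *\<^sub>R basis_vec l * a i k *\<^sub>R basis_vec k)"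
        unfolding mult_scaleR_left mult_scaleR_right
        by (subst basis_vec_anticommute) (simp add: mult.commute)
    qed simp_all
    also have "\<dots> = - (row_vec X a j * row_vec X a i)"
      by (simp only: row_vec_def sum_product sum_negf)
    finally show ?thesis .
  qed
  then show ?thesis unfolding anticommuting_def by blast
qed

text \<open>Applied to a wedge of further rows, this is Laplace expansion along the first row, since
  the coordinate at \<open>T\<close> is the minor with columns \<open>T\<close>. It drives the
  inductions on minors below.\<close>

lemma coord_row_vec_times:
  assumes "finite X"
  shows "coord (row_vec X a i * x) T =
    (\<Sum>t\<in>T \<inter> X. (-1) ^ card {u \<in> T. u < t} * a i t * coord x (T - {t}))"
proof -
  have "coord (row_vec X a i * x) T =
      (\<Sum>t\<in>X. if t \<in> T then (-1) ^ card {u \<in> T. u < t} * a i t * coord x (T - {t}) else 0)"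
    by (auto simp: row_vec_def sum_distrib_right coord_sum coord_simps coord_basis_vec_times
        intro!: sum.cong)
  then show ?thesis
    using assms by (simp add: sum.inter_restrict[symmetric] Int_commute)
qed

text \<open>The sign of the permutation sorting the images under \<open>\<theta>\<close> of the elements of \<open>T\<close>.\<close>

definition relabel_sign :: "(nat \<Rightarrow> nat) \<Rightarrow> nat set \<Rightarrow> real" where
  "relabel_sign \<theta> T = (-1) ^ card {(u, w). u \<in> T \<and> w \<in> T \<and> u < w \<and> \<theta> w < \<theta> u}"

lemma relabel_sign_nonzero [simp]: "relabel_sign \<theta> T \<noteq> 0"
  by (simp add: relabel_sign_def)

text \<open>Removing \<open>t\<close> lowers the inversion count by \<open>card C + card D\<close>,
  while \<open>t\<close> has \<open>card C + card E\<close> smaller elements in \<open>T\<close> and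
  \<open>card D + card E\<close> smaller images. The exponents of the two sides differ by
  \<open>2 * card C\<close>, so the signs agree.\<close>

lemma relabel_sign_remove:
  assumes "finite T" "inj_on \<theta> T" "t \<in> T"
  shows "(-1) ^ card {u \<in> \<theta> ` T. u < \<theta> t} * relabel_sign \<theta> (T - {t})
    = relabel_sign \<theta> T * (-1) ^ card {u \<in> T. u < t}"
proof -
  define A where "A = {u \<in> T. \<theta> u < \<theta> t}"
  define B where "B = {u \<in> T. u < t}"
  define C where "C = {u \<in> T. u < t \<and> \<theta> t < \<theta> u}"
  define D where "D = {u \<in> T. t < u \<and> \<theta> u < \<theta> t}"
  define E where "E = {u \<in> T. u < t \<and> \<theta> u < \<theta> t}"
  define P where "P = {(u, w). u \<in> T - {t} \<and> w \<in> T - {t} \<and> u < w \<and> \<theta> w < \<theta> u}"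
  have ne: "\<theta> u \<noteq> \<theta> t" if "u \<in> T" "u \<noteq> t" for u
    using that assms by (auto dest: inj_onD)
  have fin: "finite C" "finite D" "finite E" "finite P"
    using assms(1) finite_subset[of P "T \<times> T"]
    by (auto simp: C_def D_def E_def P_def)
  have "{u \<in> \<theta> ` T. u < \<theta> t} = \<theta> ` A" by (auto simp: A_def)
  then have 1: "card {u \<in> \<theta> ` T. u < \<theta> t} = card A"
    using assms(2) by (auto simp: A_def intro!: card_image inj_on_subset[OF assms(2)])
  have "A = D \<union> E" using ne by (auto simp: A_def D_def E_def) (metis nat_neq_iff)
  moreover have "D \<inter> E = {}" by (auto simp: D_def E_def)
  ultimately have 2: "card A = card D + card E"
    using fin by (simp add: card_Un_disjoint)
  have "B = C \<union> E" using ne by (auto simp: B_def C_def E_def) (metis nat_neq_iff)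
  moreover have "C \<inter> E = {}" by (auto simp: C_def E_def)
  ultimately have 3: "card B = card C + card E"
    using fin by (simp add: card_Un_disjoint)
  have "{(u, w). u \<in> T \<and> w \<in> T \<and> u < w \<and> \<theta> w < \<theta> u} =
      P \<union> ((\<lambda>u. (u, t)) ` C \<union> (\<lambda>w. (t, w)) ` D)" (is "?Q = _")
    using assms(3) by (auto simp: P_def C_def D_def)
  moreover have "card (P \<union> ((\<lambda>u. (u, t)) ` C \<union> (\<lambda>w. (t, w)) ` D)) = card P + (card C + card D)"
    using fin
    by (subst card_Un_disjoint, simp, simp, force simp: P_def)
      (subst card_Un_disjoint; force simp: C_def D_def card_image inj_on_def)
  ultimately have 4: "card ?Q = card P + (card C + card D)" by simp
  show ?thesis
    unfolding relabel_sign_def 1 4 P_def[symmetric] B_def[symmetric] 2 3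
    by (simp add: power_add mult_ac)
qed

text \<open>Rearranging the columns of a minor multiplies it by the sign of the permutation; the
  proof expands along the first row. The sign depends on \<open>T\<close> but not on
  \<open>S\<close>, so linear relations among the wedges survive a relabelling.\<close>

lemma coord_wedge_relabel:
  assumes "finite S" "finite X" "finite Y" "T \<subseteq> X" "\<theta> ` T \<subseteq> Y" "inj_on \<theta> T"
    and "\<And>s t. s \<in> S \<Longrightarrow> t \<in> T \<Longrightarrow> b s (\<theta> t) = a s t"
  shows "coord (wedge (row_vec Y b) S) (\<theta> ` T) =
    relabel_sign \<theta> T * coord (wedge (row_vec X a) S) T"
  using assms(1,4-)
proof (induction S arbitrary: T rule: finite_linorder_min_induct)
  case empty
  then show ?case by (auto simp: one_exterior.rep_eq relabel_sign_def)
next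
  case (insert s S)
  have fin: "finite T" using insert.prems assms(2) by (auto intro: finite_subset)
  have w: "wedge g (insert s S) = g s * wedge g S" for g
    using insert.hyps by (intro wedge_insert_min) auto
  have "coord (wedge (row_vec Y b) (insert s S)) (\<theta> ` T) =
      (\<Sum>t\<in>T. (-1) ^ card {u \<in> \<theta> ` T. u < \<theta> t} * b s (\<theta> t) *
        coord (wedge (row_vec Y b) S) (\<theta> ` T - {\<theta> t}))"
    unfolding w coord_row_vec_times[OF assms(3)] using insert.prems
    by (simp add: inf_absorb1 sum.reindex)
  also have "\<dots> = (\<Sum>t\<in>T. relabel_sign \<theta> T * ((-1) ^ card {u \<in> T. u < t} * a s t *
      coord (wedge (row_vec X a) S) (T - {t})))"
  proof (rule sum.cong)
    fix t assume t: "t \<in> T"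
    have "\<theta> ` T - {\<theta> t} = \<theta> ` (T - {t})"
      using t insert.prems(3) by (auto dest: inj_onD)
    moreover have "coord (wedge (row_vec Y b) S) (\<theta> ` (T - {t})) =
        relabel_sign \<theta> (T - {t}) * coord (wedge (row_vec X a) S) (T - {t})"
      using insert.prems by (intro insert.IH) (auto intro: inj_on_subset)
    ultimately show "(-1) ^ card {u \<in> \<theta> ` T. u < \<theta> t} * b s (\<theta> t) *
        coord (wedge (row_vec Y b) S) (\<theta> ` T - {\<theta> t}) =
        relabel_sign \<theta> T * ((-1) ^ card {u \<in> T. u < t} * a s t *
          coord (wedge (row_vec X a) S) (T - {t}))"
      using relabel_sign_remove[OF fin insert.prems(3) t] insert.prems(4)[of s t] t
      by (simp add: mult_ac)
  qed simp
  also have "\<dots> = relabel_sign \<theta> T * coord (wedge (row_vec X a) (insert s S)) T"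
    unfolding w coord_row_vec_times[OF assms(2)] using insert.prems
    by (simp add: inf_absorb1 sum_distrib_left)
  finally show ?case .
qed

lemma relabel_sign_id: "relabel_sign (\<lambda>t. t) T = 1"
proof -
  have "{(u, w). u \<in> T \<and> w \<in> T \<and> u < w \<and> w < u} = {}" by auto
  then show ?thesis unfolding relabel_sign_def by (simp only: card.empty power_0)
qed

text \<open>The relabelling lemma for the identity: a minor sees only its own rows and columns,
  whatever further columns are present.\<close>

lemma coord_wedge_row_vec_cong:
  assumes "finite S" "finite X" "finite Y" "T \<subseteq> X" "T \<subseteq> Y"
    and "\<And>s t. s \<in> S \<Longrightarrow> t \<in> T \<Longrightarrow> b s t = a s t"
  shows "coord (wedge (row_vec Y b) S) T = coord (wedge (row_vec X a) S) T"
  using coord_wedge_relabel[of S X Y T "\<lambda>t. t" b a] assms by (simp add: relabel_sign_id)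

section \<open>Polynomial functions and generic points\<close>

definition monom_eval :: "('i \<Rightarrow> real) \<Rightarrow> ('i \<Rightarrow>\<^sub>0 nat) \<Rightarrow> real" where
  "monom_eval x m = (\<Prod>i\<in>Poly_Mapping.keys m. x i ^ Poly_Mapping.lookup m i)"

lemma monom_eval_superset:
  assumes "finite A" "Poly_Mapping.keys m \<subseteq> A"
  shows "monom_eval x m = (\<Prod>i\<in>A. x i ^ Poly_Mapping.lookup m i)"
  unfolding monom_eval_def using assms
  by (intro prod.mono_neutral_left) (auto simp: in_keys_iff)

lemma monom_eval_add: "monom_eval x (a + b) = monom_eval x a * monom_eval x b"
proof -
  let ?A = "Poly_Mapping.keys a \<union> Poly_Mapping.keys b"
  have "monom_eval x m = (\<Prod>i\<in>?A. x i ^ Poly_Mapping.lookup m i)"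
    if "Poly_Mapping.keys m \<subseteq> ?A" for m
    using that by (intro monom_eval_superset) auto
  then show ?thesis
    using keys_add[of a b] by (simp add: lookup_add power_add prod.distrib)
qed

lemma poly_eval_superset:
  assumes "finite A" "Poly_Mapping.keys p \<subseteq> A"
  shows "poly_eval x p = (\<Sum>m\<in>A. of_rat (Poly_Mapping.lookup p m) * monom_eval x m)"
  unfolding poly_eval_def monom_eval_def[symmetric] using assms
  by (intro sum.mono_neutral_left) (auto simp: in_keys_iff)

lemma poly_eval_add: "poly_eval x (p + q) = poly_eval x p + poly_eval x q"
proof -
  let ?A = "Poly_Mapping.keys p \<union> Poly_Mapping.keys q"
  have "poly_eval x r = (\<Sum>m\<in>?A. of_rat (Poly_Mapping.lookup r m) * monom_eval x m)"
    if "Poly_Mapping.keys r \<subseteq> ?A" for r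
    using that by (intro poly_eval_superset) auto
  then show ?thesis
    using keys_add[of p q] by (simp add: lookup_add of_rat_add algebra_simps sum.distrib)
qed

lemma poly_eval_zero [simp]: "poly_eval x 0 = 0"
  by (simp add: poly_eval_def)

lemma poly_eval_sum: "poly_eval x (\<Sum>a\<in>A. p a) = (\<Sum>a\<in>A. poly_eval x (p a))"
  by (induction A rule: infinite_finite_induct) (simp_all add: poly_eval_add)

lemma poly_eval_single: "poly_eval x (Poly_Mapping.single m c) = of_rat c * monom_eval x m"
  by (simp add: poly_eval_superset[of "{m}"])

lemma poly_mapping_eq_sum_single:
  "p = (\<Sum>m\<in>Poly_Mapping.keys p. Poly_Mapping.single m (Poly_Mapping.lookup p m))"
  by (rule poly_mapping_eqI)
    (auto simp: lookup_sum lookup_single when_def in_keys_iff)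

lemma poly_eval_mult: "poly_eval x (p * q) = poly_eval x p * poly_eval x q"
proof -
  have "p * q = (\<Sum>a\<in>Poly_Mapping.keys p. \<Sum>b\<in>Poly_Mapping.keys q.
      Poly_Mapping.single (a + b) (Poly_Mapping.lookup p a * Poly_Mapping.lookup q b))"
    by (subst poly_mapping_eq_sum_single[of p], subst poly_mapping_eq_sum_single[of q])
      (simp only: sum_product mult_single)
  then show ?thesis
    by (simp add: poly_eval_sum poly_eval_single monom_eval_add of_rat_mult)
      (simp add: poly_eval_def monom_eval_def sum_product mult_ac)
qed

lemma poly_vars_add: "poly_vars (p + q) \<subseteq> poly_vars p \<union> poly_vars q"
  unfolding poly_vars_def using keys_add[of p q] by blast

lemma poly_vars_mult: "poly_vars (p * q) \<subseteq> poly_vars p \<union> poly_vars q"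
proof
  fix i assume "i \<in> poly_vars (p * q)"
  then obtain m where "m \<in> Poly_Mapping.keys (p * q)" "i \<in> Poly_Mapping.keys m"
    by (auto simp: poly_vars_def)
  moreover from this obtain a b where "m = a + b" "a \<in> Poly_Mapping.keys p" "b \<in> Poly_Mapping.keys q"
    using keys_mult[of p q] by blast
  ultimately show "i \<in> poly_vars p \<union> poly_vars q"
    using keys_add[of a b] by (auto simp: poly_vars_def)
qed

text \<open>Working with functions turns substitution into composition and makes closure properties
  inductions. The constants are rational because algebraic independence is over the
  rationals.\<close>

inductive_set polyfun :: "'i set \<Rightarrow> (('i \<Rightarrow> real) \<Rightarrow> real) set" for I where
  const: "(\<lambda>x. of_rat c) \<in> polyfun I"
| var: "i \<in> I \<Longrightarrow> (\<lambda>x. x i) \<in> polyfun I"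
| add: "F \<in> polyfun I \<Longrightarrow> G \<in> polyfun I \<Longrightarrow> (\<lambda>x. F x + G x) \<in> polyfun I"
| mult: "F \<in> polyfun I \<Longrightarrow> G \<in> polyfun I \<Longrightarrow> (\<lambda>x. F x * G x) \<in> polyfun I"

lemma polyfun_imp_poly:
  assumes "F \<in> polyfun I"
  shows "\<exists>p. poly_vars p \<subseteq> I \<and> F = (\<lambda>x. poly_eval x p)"
  using assms
proof induction
  case (const c)
  have "poly_eval x (Poly_Mapping.single 0 c) = of_rat c" for x :: "'a \<Rightarrow> real"
    by (simp add: poly_eval_single monom_eval_def)
  then show ?case
    by (intro exI[of _ "Poly_Mapping.single 0 c"]) (auto simp: poly_vars_def)
next
  case (var i)
  have "poly_eval x (Poly_Mapping.single (Poly_Mapping.single i 1) 1) = x i" for x :: "'a \<Rightarrow> real"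
    by (simp add: poly_eval_single monom_eval_def)
  then show ?case using var
    by (intro exI[of _ "Poly_Mapping.single (Poly_Mapping.single i 1) 1"]) (auto simp: poly_vars_def)
next
  case (add F G)
  then obtain p q where "poly_vars p \<subseteq> I" "F = (\<lambda>x. poly_eval x p)"
    "poly_vars q \<subseteq> I" "G = (\<lambda>x. poly_eval x q)" by auto
  then show ?case using poly_vars_add[of p q]
    by (intro exI[of _ "p + q"]) (auto simp: poly_eval_add)
next
  case (mult F G)
  then obtain p q where "poly_vars p \<subseteq> I" "F = (\<lambda>x. poly_eval x p)"
    "poly_vars q \<subseteq> I" "G = (\<lambda>x. poly_eval x q)" by auto
  then show ?case using poly_vars_mult[of p q]
    by (intro exI[of _ "p * q"]) (auto simp: poly_eval_mult)
qed

lemma polyfun_cong: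
  assumes "F \<in> polyfun I" "\<And>i. i \<in> I \<Longrightarrow> x i = y i"
  shows "F x = F y"
  using assms by induction auto

lemma polyfun_compose:
  assumes "F \<in> polyfun I" "\<And>i. i \<in> I \<Longrightarrow> G i \<in> polyfun J"
  shows "(\<lambda>x. F (\<lambda>i. G i x)) \<in> polyfun J"
  using assms by induction (auto intro: polyfun.intros)

lemma polyfun_0: "(\<lambda>x. 0) \<in> polyfun I"
  using polyfun.const[of 0] by simp

lemma polyfun_uminus: "F \<in> polyfun I \<Longrightarrow> (\<lambda>x. - F x) \<in> polyfun I"
  using polyfun.mult[OF polyfun.const[of "-1"]] by (fastforce simp: of_rat_minus)

lemma polyfun_diff: "F \<in> polyfun I \<Longrightarrow> G \<in> polyfun I \<Longrightarrow> (\<lambda>x. F x - G x) \<in> polyfun I"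
  using polyfun.add[of F I "\<lambda>x. - G x"] polyfun_uminus[of G I] by simp

lemma polyfun_sum: "(\<And>k. k \<in> A \<Longrightarrow> F k \<in> polyfun I) \<Longrightarrow> (\<lambda>x. \<Sum>k\<in>A. F k x) \<in> polyfun I"
  by (induction A rule: infinite_finite_induct) (auto intro: polyfun_0 polyfun.add)

text \<open>The conclusion concerns the function, not a formal polynomial. Any two such points have
  the same vanishing polynomials, which is all that the comparison of two matrices uses.\<close>

definition generic_point :: "'i set \<Rightarrow> ('i \<Rightarrow> real) \<Rightarrow> bool" where
  "generic_point I x \<longleftrightarrow> (\<forall>F\<in>polyfun I. F x = 0 \<longrightarrow> (\<forall>y. F y = 0))"

lemma generic_point_same_zeros:
  "generic_point I x \<Longrightarrow> generic_point I y \<Longrightarrow> F \<in> polyfun I \<Longrightarrow> F x = 0 \<longleftrightarrow> F y = 0"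
  unfolding generic_point_def by blast

lemma algebraically_independent_imp_generic_point:
  assumes "algebraically_independent I x"
  shows "generic_point I x"
  unfolding generic_point_def
proof (intro ballI impI allI)
  fix F y assume "F \<in> polyfun I" "F x = 0"
  then obtain p where "poly_vars p \<subseteq> I" "F = (\<lambda>x. poly_eval x p)" "poly_eval x p = 0"
    using polyfun_imp_poly by blast
  then show "F y = 0"
    using assms unfolding algebraically_independent_def by force
qed

text \<open>If \<open>F\<close> vanishes at the image of \<open>x\<close>, then \<open>F\<close>
  composed with \<open>G\<close> vanishes at \<open>x\<close> and hence everywhere; since
  \<open>G\<close> attains all values on \<open>I\<close>, \<open>F\<close> itself vanishes
  everywhere.\<close>

lemma generic_point_compose:
  assumes "generic_point J x" "\<And>i. i \<in> I \<Longrightarrow> G i \<in> polyfun J"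
    and surj: "\<And>y. \<exists>z. \<forall>i\<in>I. G i z = y i"
  shows "generic_point I (\<lambda>i. G i x)"
  unfolding generic_point_def
proof (intro ballI impI allI)
  fix F y assume F: "F \<in> polyfun I" "F (\<lambda>i. G i x) = 0"
  obtain z where "\<forall>i\<in>I. G i z = y i" using surj by blast
  then have "F (\<lambda>i. G i z) = F y"
    by (intro polyfun_cong[OF F(1)]) auto
  moreover have "(\<lambda>x. F (\<lambda>i. G i x)) \<in> polyfun J"
    using F(1) assms(2) by (rule polyfun_compose)
  from bspec[OF assms(1)[unfolded generic_point_def] this] have "F (\<lambda>i. G i z) = 0"
    using F(2) by simp
  ultimately show "F y = 0" by simp
qed

lemma polyfun_mono:
  assumes "F \<in> polyfun I" "I \<subseteq> J"
  shows "F \<in> polyfun J"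
  using assms(1)
proof induction
  case (var i)
  then have "i \<in> J" using assms(2) by blast
  then show ?case by (rule polyfun.var)
qed (intro polyfun.intros; assumption)+

lemma generic_point_subset:
  assumes "generic_point J x" "I \<subseteq> J"
  shows "generic_point I x"
  unfolding generic_point_def
proof
  fix F assume "F \<in> polyfun I"
  then have "F \<in> polyfun J" using assms(2) by (rule polyfun_mono)
  then show "F x = 0 \<longrightarrow> (\<forall>y. F y = 0)"
    by (rule bspec[OF assms(1)[unfolded generic_point_def]])
qed

lemma generic_point_cong:
  assumes "generic_point I x" "\<And>i. i \<in> I \<Longrightarrow> x i = y i"
  shows "generic_point I y"
  unfolding generic_point_def
proof (intro ballI impI)
  fix F assume F: "F \<in> polyfun I" "F y = 0"
  have "F x = F y" using F(1) assms(2) by (rule polyfun_cong)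
  with bspec[OF assms(1)[unfolded generic_point_def] F(1)] F(2) show "\<forall>y. F y = 0" by simp
qed

text \<open>Fraction-free Gaussian elimination: every pivot decision is a vanishing test of a polynomial.\<close>

lemma span_transfer_polyfun:
  assumes "finite A"
    and "\<And>F. F \<in> polyfun I \<Longrightarrow> F x = 0 \<longleftrightarrow> F y = 0"
    and "\<And>t. t \<in> L \<Longrightarrow> u t \<in> polyfun I"
    and "\<And>k t. k \<in> A \<Longrightarrow> t \<in> L \<Longrightarrow> w k t \<in> polyfun I"
    and "\<forall>t\<in>L. u t x = (\<Sum>k\<in>A. c k * w k t x)"
  shows "\<exists>c'. \<forall>t\<in>L. u t y = (\<Sum>k\<in>A. c' k * w k t y)"
  using assms(1,3-)
proof (induction A arbitrary: u w c)
  case empty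
  then show ?case using assms(2) by auto
next
  case (insert k A)
  have split: "(\<Sum>l\<in>insert k A. c l * f l) = c k * f k + (\<Sum>l\<in>A. c l * f l)" for c f :: "_ \<Rightarrow> real"
    using insert.hyps by simp
  show ?case
  proof (cases "\<forall>t\<in>L. w k t x = 0")
    case True
    then have "\<exists>c'. \<forall>t\<in>L. u t y = (\<Sum>k\<in>A. c' k * w k t y)"
      using insert.prems by (intro insert.IH[where c = c]) (auto simp: split)
    then obtain c' where c': "\<forall>t\<in>L. u t y = (\<Sum>k\<in>A. c' k * w k t y)" by blast
    have "w k t y = 0" if "t \<in> L" for t
      using that True insert.prems(2)[of k t] assms(2) by auto
    then show ?thesis using c' by (auto simp: split)
  next
    case False
    then obtain t0 where t0: "t0 \<in> L" "w k t0 x \<noteq> 0" by blast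
    \<comment> \<open>Cross-multiplication with the equation at the pivot \<open>t0\<close> cancels
      the \<open>k\<close>-th term without division. The entries stay polynomial, and the relation
      at \<open>x\<close> keeps the coefficients \<open>c l\<close>.\<close>
    define e where "e f t = (\<lambda>z. w k t0 z * f t z - f t0 z * w k t z)"
      for f :: "_ \<Rightarrow> (_ \<Rightarrow> real) \<Rightarrow> real" and t
    have poly: "e f t \<in> polyfun I" if "\<And>t. t \<in> L \<Longrightarrow> f t \<in> polyfun I" "t \<in> L" for f t
      unfolding e_def using that t0 insert.prems(2)
      by (intro polyfun_diff polyfun.mult) auto
    have "e u t x = (\<Sum>l\<in>A. c l * e (w l) t x)" if "t \<in> L" for t
    proof -
      have "u t x = c k * w k t x + (\<Sum>l\<in>A. c l * w l t x)"
        "u t0 x = c k * w k t0 x + (\<Sum>l\<in>A. c l * w l t0 x)"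
        using insert.prems(3) that t0 split by auto
      then show ?thesis
        by (simp add: e_def algebra_simps sum_subtractf sum_distrib_left)
    qed
    then have "\<exists>c'. \<forall>t\<in>L. e u t y = (\<Sum>l\<in>A. c' l * e (w l) t y)"
      using insert.prems by (intro insert.IH[where c = c] poly) auto
    then obtain c' where c': "\<And>t. t \<in> L \<Longrightarrow> e u t y = (\<Sum>l\<in>A. c' l * e (w l) t y)" by blast
    define d where "d = w k t0 y"
    have d: "d \<noteq> 0"
      using t0 insert.prems(2)[of k t0] assms(2) by (auto simp: d_def)
    \<comment> \<open>The coefficient of \<open>w k\<close> is read off from the equation at
      \<open>t0\<close>; the pivot is nonzero at \<open>y\<close> because it is nonzero at
      \<open>x\<close>.\<close>
    define b where "b = (u t0 y - (\<Sum>l\<in>A. c' l * w l t0 y)) / d"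
    have b: "d * b = u t0 y - (\<Sum>l\<in>A. c' l * w l t0 y)"
      using d by (simp add: b_def)
    have "u t y = b * w k t y + (\<Sum>l\<in>A. c' l * w l t y)" if "t \<in> L" for t
    proof -
      have "d * u t y - u t0 y * w k t y =
          d * (\<Sum>l\<in>A. c' l * w l t y) - (\<Sum>l\<in>A. c' l * w l t0 y) * w k t y"
        using c'[OF that] by (simp add: e_def d_def algebra_simps sum_subtractf sum_distrib_left)
      then have "d * u t y = d * (b * w k t y + (\<Sum>l\<in>A. c' l * w l t y))"
        unfolding distrib_left mult.assoc[symmetric] b by (simp add: algebra_simps)
      then show ?thesis using d by simp
    qed
    moreover have "(\<Sum>l\<in>A. (c'(k := b)) l * w l t y) = (\<Sum>l\<in>A. c' l * w l t y)" for t
      using insert.hyps by (intro sum.cong) auto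
    ultimately show ?thesis
      by (intro exI[of _ "c'(k := b)"]) (simp add: split)
  qed
qed

section \<open>Lexicographic order and spans of wedge products\<close>

text \<open>Replaces the minimum of the symmetric difference by a witness: the first place where the
  sets differ.\<close>

lemma lex_less_iff:
  assumes "finite S" "finite T"
  shows "lex_less S T \<longleftrightarrow> card S = card T \<and> (\<exists>x. x \<in> S \<and> x \<notin> T \<and> (\<forall>y<x. y \<in> S \<longleftrightarrow> y \<in> T))"
proof -
  let ?D = "(S - T) \<union> (T - S)"
  have fin: "finite ?D" using assms by auto
  show ?thesis
  proof
    assume *: "lex_less S T"
    then have "?D \<noteq> {}" by (auto simp: lex_less_def)
    then have "Min ?D \<in> ?D" using fin by (rule Min_in[rotated])
    moreover have "y \<in> S \<longleftrightarrow> y \<in> T" if "y < Min ?D" for y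
      using that fin \<open>?D \<noteq> {}\<close> by auto
    ultimately show "card S = card T \<and> (\<exists>x. x \<in> S \<and> x \<notin> T \<and> (\<forall>y<x. y \<in> S \<longleftrightarrow> y \<in> T))"
      using * by (intro conjI exI[of _ "Min ?D"]) (auto simp: lex_less_def)
  next
    assume "card S = card T \<and> (\<exists>x. x \<in> S \<and> x \<notin> T \<and> (\<forall>y<x. y \<in> S \<longleftrightarrow> y \<in> T))"
    then obtain x where x: "card S = card T" "x \<in> S" "x \<notin> T" "\<forall>y<x. y \<in> S \<longleftrightarrow> y \<in> T" by blast
    have "Min ?D = x"
      using fin x by (intro Min_eqI) (auto simp: not_less[symmetric])
    then show "lex_less S T" using x by (auto simp: lex_less_def)
  qed
qed

lemma lex_less_trans:
  assumes "finite S" "finite T" "finite U" "lex_less S T" "lex_less T U"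
  shows "lex_less S U"
proof -
  obtain x where x: "x \<in> S" "x \<notin> T" "\<forall>y<x. y \<in> S \<longleftrightarrow> y \<in> T"
    using assms by (auto simp: lex_less_iff)
  obtain z where z: "z \<in> T" "z \<notin> U" "\<forall>y<z. y \<in> T \<longleftrightarrow> y \<in> U"
    using assms by (auto simp: lex_less_iff)
  have "x \<noteq> z" using x z by auto
  \<comment> \<open>The first difference between \<open>S\<close> and \<open>U\<close> is the
    earlier of the two given ones.\<close>
  then have "min x z \<in> S \<and> min x z \<notin> U \<and> (\<forall>y<min x z. y \<in> S \<longleftrightarrow> y \<in> U)"
    using x z by (cases "x < z") (auto simp: min_def)
  then show ?thesis
    using assms unfolding lex_less_iff[OF assms(1,3)] by (auto simp: lex_less_def)
qed

lemma lex_less_exchange: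
  assumes "finite S" "i \<in> S" "j \<notin> S" "j < i"
  shows "lex_less (insert j (S - {i})) S"
proof -
  have "card (insert j (S - {i})) = card S"
    using assms by (metis Diff_iff card_Suc_Diff1 card_insert_disjoint finite_Diff)
  then show ?thesis
    using assms by (subst lex_less_iff) (auto intro!: exI[of _ j])
qed

text \<open>The coefficients are indexed by \<open>A\<close> rather than by its image, so
  \<open>f\<close> may take the same value twice.\<close>

lemma span_image_explicit:
  fixes f :: "'i \<Rightarrow> 'v::real_vector"
  assumes "finite A"
  shows "y \<in> span (f ` A) \<longleftrightarrow> (\<exists>c. y = (\<Sum>a\<in>A. c a *\<^sub>R f a))"
  using assms
proof (induction A arbitrary: y)
  case empty
  then show ?case by simp
next
  case (insert a A)
  have "(\<exists>k c. y - k *\<^sub>R f a = (\<Sum>a\<in>A. c a *\<^sub>R f a)) \<longleftrightarrow> (\<exists>c. y = (\<Sum>a\<in>insert a A. c a *\<^sub>R f a))"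
  proof safe
    fix k c assume *: "y - k *\<^sub>R f a = (\<Sum>a\<in>A. c a *\<^sub>R f a)"
    have "(\<Sum>b\<in>A. (c(a := k)) b *\<^sub>R f b) = (\<Sum>b\<in>A. c b *\<^sub>R f b)"
      using insert.hyps by (intro sum.cong) auto
    then show "\<exists>c. y = (\<Sum>a\<in>insert a A. c a *\<^sub>R f a)"
      using * insert.hyps by (intro exI[of _ "c(a := k)"]) (simp add: algebra_simps)
  next
    fix c assume "y = (\<Sum>a\<in>insert a A. c a *\<^sub>R f a)"
    then show "\<exists>k d. (\<Sum>a\<in>insert a A. c a *\<^sub>R f a) - k *\<^sub>R f a = (\<Sum>a\<in>A. d a *\<^sub>R f a)"
      using insert.hyps by (intro exI[of _ "c a"] exI[of _ c]) simp
  qed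
  then show ?case
    using insert.IH by (simp add: span_breakdown_eq)
qed

text \<open>Bring the factor \<open>h i\<close> to the front, expand it in the \<open>h j\<close>
  with \<open>j\<close> in \<open>P\<close>, and put each \<open>h j\<close> back in place; an index
  already in \<open>S - {i}\<close> gives zero.\<close>

lemma wedge_exchange:
  assumes "anticommuting h" "finite S" "i \<in> S" "h i \<in> span (h ` P)"
  shows "wedge h S \<in> span ((\<lambda>j. wedge h (insert j (S - {i}))) ` (P - (S - {i})))"
    (is "_ \<in> span ?B")
proof -
  have "y * wedge h (S - {i}) \<in> span ?B" if "y \<in> span (h ` P)" for y
    using that
  proof (induction rule: span_induct_alt)
    case base
    then show ?case by (simp add: span_zero)
  next
    case (step c x y)
    then obtain j where j: "j \<in> P" "x = h j" by auto
    have "h j * wedge h (S - {i}) \<in> span ?B"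
      using j assms(2) by (subst times_wedge[OF assms(1)])
        (auto intro: span_zero span_scale span_base)
    then show ?case
      using step j by (auto simp: distrib_right intro!: span_add span_scale)
  qed
  from this[OF assms(4)] have "(-1) ^ card {t \<in> S - {i}. t < i} *\<^sub>R wedge h S \<in> span ?B"
    using assms(2,3) by (subst (asm) times_wedge[OF assms(1)]) (auto simp: insert_absorb)
  from span_scale[OF this, of "(-1) ^ card {t \<in> S - {i}. t < i}"] show ?thesis
    by (simp flip: power_mult_distrib)
qed

text \<open>An index beyond \<open>p\<close> is exchanged for indices of \<open>{1..p}\<close>. Each
  exchange lowers the number of indices outside \<open>{1..p}\<close>, and it moves the set earlier
  because the new index is smaller than the old one.\<close>

lemma wedge_in_span_initial:
  assumes "anticommuting h" "finite S" "\<And>i. i \<in> S \<Longrightarrow> 1 \<le> i \<and> h i \<in> span (h ` {1..p})"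
  shows "wedge h S \<in> span (wedge h ` {U. U \<subseteq> {1..p} \<and> card U = card S \<and> (U = S \<or> lex_less U S)})"
  using assms(2,3)
proof (induction "card (S - {1..p})" arbitrary: S rule: less_induct)
  case less
  let ?B = "\<lambda>S. {U. U \<subseteq> {1..p} \<and> card U = card S \<and> (U = S \<or> lex_less U S)}"
  show ?case
  proof (cases "S \<subseteq> {1..p}")
    case True
    then show ?thesis by (intro span_base) auto
  next
    case False
    then obtain i where i: "i \<in> S" "i \<notin> {1..p}" by blast
    \<comment> \<open>An index outside \<open>{1..p}\<close> exceeds \<open>p\<close> only because 0
      is excluded by the assumption \<open>1 \<le> i\<close>.\<close>
    then have "p < i" using less.prems(2)[OF i(1)] by auto
    have "wedge h (insert j (S - {i})) \<in> span (wedge h ` ?B S)" if j: "j \<in> {1..p} - (S - {i})" for j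
    proof -
      let ?S = "insert j (S - {i})"
      have "j \<notin> S" "j < i" using j i \<open>p < i\<close> by auto
      then have lex: "lex_less ?S S"
        using i less.prems by (intro lex_less_exchange) auto
      have card: "card ?S = card S" using lex by (simp add: lex_less_def)
      have "?S - {1..p} = (S - {1..p}) - {i}" using j by auto
      then have "card (?S - {1..p}) < card (S - {1..p})"
        using i less.prems(1) by (simp only:) (intro card_Diff1_less, auto)
      moreover have "1 \<le> k \<and> h k \<in> span (h ` {1..p})" if "k \<in> ?S" for k
      proof (cases "k = j")
        case True
        have "h j \<in> span (h ` {1..p})" using j by (intro span_base) blast
        then show ?thesis using True j by simp
      qed (use that less.prems(2) in blast)
      ultimately have "wedge h ?S \<in> span (wedge h ` ?B ?S)"
        using less.prems(1) by (intro less.hyps) auto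
      moreover have "?B ?S \<subseteq> ?B S"
      proof
        fix U assume U: "U \<in> ?B ?S"
        then have "finite U" using finite_subset[of U "{1..p}"] by simp
        then have "lex_less U S" if "lex_less U ?S"
          using that lex less.prems(1) by (intro lex_less_trans[of U ?S S]) auto
        then show "U \<in> ?B S" using U card lex by auto
      qed
      ultimately show ?thesis
        using span_mono[OF image_mono[of "?B ?S" "?B S" "wedge h"]] by blast
    qed
    then have "span ((\<lambda>j. wedge h (insert j (S - {i}))) ` ({1..p} - (S - {i}))) \<subseteq> span (wedge h ` ?B S)"
      by (intro span_minimal subspace_span image_subsetI)
    moreover have "wedge h S \<in> span ((\<lambda>j. wedge h (insert j (S - {i}))) ` ({1..p} - (S - {i})))"
      using less.prems i by (intro wedge_exchange[OF assms(1)]) blast+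
    ultimately show ?thesis by (rule subsetD)
  qed
qed

text \<open>If \<open>h i\<close> were in the span of the other factors,
  \<open>wedge_exchange\<close> with \<open>P = S - {i}\<close> would leave no index to insert, so
  the wedge would lie in the span of the empty set.\<close>

lemma inj_on_independent_if_wedge_nonzero:
  assumes "anticommuting h" "finite S" "wedge h S \<noteq> 0"
  shows "inj_on h S" "independent (h ` S)"
proof -
  have *: "h i \<notin> span (h ` (S - {i}))" if "i \<in> S" for i
  proof
    assume "h i \<in> span (h ` (S - {i}))"
    from wedge_exchange[OF assms(1,2) that this] show False using assms(3) by simp
  qed
  show "inj_on h S"
  proof (rule inj_onI, rule ccontr)
    fix i j assume ij: "i \<in> S" "j \<in> S" "h i = h j" "i \<noteq> j"
    then have "h i \<in> h ` (S - {i})" by (intro image_eqI[of _ _ j]) simp_all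
    then show False using *[OF ij(1)] by (simp add: span_base)
  qed
  show "independent (h ` S)"
  proof
    assume "dependent (h ` S)"
    then obtain i where i: "i \<in> S" "h i \<in> span (h ` S - {h i})"
      unfolding dependent_def by blast
    have "span (h ` S - {h i}) \<subseteq> span (h ` (S - {i}))"
      by (rule span_mono) blast
    from this i(2) have "h i \<in> span (h ` (S - {i}))" by (rule subsetD)
    with *[OF i(1)] show False by (rule notE)
  qed
qed

section \<open>Minors: support, polynomial dependence on the entries, nonvanishing\<close>

lemma coord_wedge_row_vec_supported:
  assumes "finite S" "finite X" "coord (wedge (row_vec X a) S) T \<noteq> 0"
  shows "T \<subseteq> X"
  using assms(1,3)
proof (induction S arbitrary: T rule: finite_linorder_min_induct)
  case empty
  then show ?case by (auto simp: one_exterior.rep_eq split: if_splits)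
next
  case (insert s S)
  have "wedge (row_vec X a) (insert s S) = row_vec X a s * wedge (row_vec X a) S"
    using insert.hyps by (intro wedge_insert_min) auto
  then have "(\<Sum>t\<in>T \<inter> X. (-1) ^ card {u \<in> T. u < t} * a s t *
      coord (wedge (row_vec X a) S) (T - {t})) \<noteq> 0"
    using insert.prems by (simp only: coord_row_vec_times[OF assms(2)] not_False_eq_True)
  then obtain t where "t \<in> T \<inter> X" "coord (wedge (row_vec X a) S) (T - {t}) \<noteq> 0"
    by (rule sum.not_neutral_contains_not_neutral) auto
  then show ?case using insert.IH[of "T - {t}"] by auto
qed

lemma coord_wedge_row_vec_polyfun:
  assumes "finite S" "finite X"
  shows "(\<lambda>x. coord (wedge (row_vec X (\<lambda>i j. x (i, j))) S) T) \<in> polyfun (S \<times> X)"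
proof -
  \<comment> \<open>The set of variables is fixed through \<open>S'\<close>, since \<open>S\<close>
    shrinks in the induction.\<close>
  have "(\<lambda>x. coord (wedge (row_vec X (\<lambda>i j. x (i, j))) S) T) \<in> polyfun (S' \<times> X)" if "S \<subseteq> S'" for S'
    using assms(1) that
  proof (induction S arbitrary: T rule: finite_linorder_min_induct)
    case empty
    then show ?case
      using polyfun.const[of 1] polyfun_0 by (cases "T = {}") (simp_all add: one_exterior.rep_eq)
  next
    case (insert s S)
    have w: "wedge g (insert s S) = g s * wedge g S" for g
      using insert.hyps by (intro wedge_insert_min) auto
    have "(\<lambda>x. (-1) ^ card {u \<in> T. u < t} * x (s, t) *
        coord (wedge (row_vec X (\<lambda>i j. x (i, j))) S) (T - {t})) \<in> polyfun (S' \<times> X)"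
      if "t \<in> T \<inter> X" for t
    proof (intro polyfun.mult)
      show "(\<lambda>x. (-1) ^ card {u \<in> T. u < t}) \<in> polyfun (S' \<times> X)"
        using polyfun.const[of "(-1) ^ card {u \<in> T. u < t}" "S' \<times> X"]
        by (simp add: of_rat_power of_rat_minus)
      show "(\<lambda>x. x (s, t)) \<in> polyfun (S' \<times> X)"
        using that insert.prems by (intro polyfun.var) auto
      show "(\<lambda>x. coord (wedge (row_vec X (\<lambda>i j. x (i, j))) S) (T - {t})) \<in> polyfun (S' \<times> X)"
        using insert.prems by (intro insert.IH) auto
    qed
    then show ?case
      unfolding w coord_row_vec_times[OF assms(2)] by (rule polyfun_sum)
  qed
  from this[OF subset_refl] show ?thesis .
qed

text \<open>The minor of the first \<open>p\<close> rows is a polynomial that is not identically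
  zero, so it does not vanish at a generic matrix. These rows are therefore independent, and by
  dimension every row is in their span.\<close>

lemma generic_rows_span:
  assumes X: "finite X" "card X = p" and gen: "generic_point ({1..p} \<times> X) (\<lambda>(i, j). a i j)"
  shows "row_vec X a i \<in> span (row_vec X a ` {1..p})"
proof -
  let ?F = "\<lambda>x. coord (wedge (row_vec X (\<lambda>i j. x (i, j))) {1..p}) X"
  obtain \<sigma> where \<sigma>: "bij_betw \<sigma> {1..p} X"
    using X finite_same_card_bij[of "{1..p}" X] by auto
  \<comment> \<open>A permutation matrix: up to sign, its minor is that of the identity
    matrix.\<close>
  define y :: "nat \<times> nat \<Rightarrow> real" where "y = (\<lambda>(i, j). if j = \<sigma> i then 1 else 0)"
  have "wedge (row_vec {1..p} (\<lambda>i j. if i = j then 1 else 0)) {1..p} = wedge basis_vec {1..p}"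
    unfolding wedge_def
    by (rule arg_cong[of _ _ prod_list], rule map_cong)
      (auto simp: row_vec_def if_distrib[of "\<lambda>c. c *\<^sub>R _"] cong: if_cong)
  moreover have "(if \<sigma> t = \<sigma> s then 1 else 0) = (if s = t then 1 else 0 :: real)"
    if "s \<in> {1..p}" "t \<in> {1..p}" for s t
    using \<sigma> that by (auto simp: bij_betw_def dest: inj_onD)
  ultimately have "?F y = relabel_sign \<sigma> {1..p}"
    using \<sigma> X coord_wedge_relabel[of "{1..p}" "{1..p}" X "{1..p}" \<sigma> "\<lambda>i j. y (i, j)"
        "\<lambda>i j. if i = j then 1 else 0"]
    by (simp add: bij_betw_def y_def coord_wedge_basis_vec)
  then have "?F y \<noteq> 0" by simp
  moreover have "?F \<in> polyfun ({1..p} \<times> X)"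
    using X by (intro coord_wedge_row_vec_polyfun) auto
  ultimately have "?F (\<lambda>(i, j). a i j) \<noteq> 0"
    using bspec[OF gen[unfolded generic_point_def], of ?F] by metis
  then have "wedge (row_vec X a) {1..p} \<noteq> 0"
    by (auto simp: zero_exterior.rep_eq)
  note ind = inj_on_independent_if_wedge_nonzero[OF anticommuting_row_vec finite_atLeastAtMost this]
  let ?R = "row_vec X a ` {1..p}"
  have row: "row_vec X a k \<in> span (basis_vec ` X)" for k
    unfolding row_vec_def by (intro span_sum span_scale span_base) auto
  show ?thesis
  proof (rule ccontr)
    assume *: "row_vec X a i \<notin> span ?R"
    \<comment> \<open>A row outside the span would give \<open>p + 1\<close> independent vectors in
      the span of \<open>p\<close> basis vectors.\<close>
    then have "independent (insert (row_vec X a i) ?R)"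
      using ind(2) by (rule independent_insertI)
    then have "card (insert (row_vec X a i) ?R) \<le> card (basis_vec ` X)"
      using row X by (intro independent_span_bound[THEN conjunct2]) auto
    also have "\<dots> \<le> card X" using X(1) by (rule card_image_le)
    finally show False
      using * ind(1) X(2) by (simp add: card_image span_base card_insert_if split: if_splits)
  qed
qed

section \<open>Shifting and its independence of the choices\<close>

definition earlier :: "nat \<Rightarrow> nat set \<Rightarrow> nat set set" where
  "earlier N S = {U. U \<subseteq> {1..N} \<and> card U = card S \<and> lex_less U S}"

text \<open>Stands for membership of a residue class in a span of residue classes: modulo the
  nonface ideal, elements of \<open>exterior_upto n\<close> agree iff their coordinates on the faces
  do.\<close>

definition spanned_on :: "nat set set \<Rightarrow> exterior \<Rightarrow> exterior set \<Rightarrow> bool" where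
  "spanned_on L x A \<longleftrightarrow> (\<exists>y\<in>span A. \<forall>T\<in>L. coord y T = coord x T)"

text \<open>The vectors \<open>h\<close> are arbitrary and their number \<open>N\<close> is not tied
  to the columns, so that the definition also covers the eliminated rows.\<close>

definition shift_rows :: "nat \<Rightarrow> (nat \<Rightarrow> exterior) \<Rightarrow> nat set set \<Rightarrow> nat set set" where
  "shift_rows N h L = {S. S \<subseteq> {1..N} \<and> \<not> spanned_on L (wedge h S) (wedge h ` earlier N S)}"

lemma finite_earlier [simp]: "finite (earlier N S)"
  by (rule finite_subset[of _ "Pow {1..N}"]) (auto simp: earlier_def)

lemma earlierD:
  assumes "U \<in> earlier N S"
  shows "finite U" "U \<subseteq> {1..N}" "card U = card S" "lex_less U S"
  using assms finite_subset[of U "{1..N}"] by (simp_all add: earlier_def)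

text \<open>Puts the condition into the form of a linear system, one equation for each face, to
  which \<open>span_transfer_polyfun\<close> applies.\<close>

lemma spanned_on_image:
  assumes "finite A"
  shows "spanned_on L x (f ` A) \<longleftrightarrow> (\<exists>c. \<forall>T\<in>L. coord x T = (\<Sum>a\<in>A. c a * coord (f a) T))"
proof -
  have *: "coord (\<Sum>a\<in>A. c a *\<^sub>R f a) T = (\<Sum>a\<in>A. c a * coord (f a) T)" for c T
    by (simp add: coord_sum coord_simps)
  have "spanned_on L x (f ` A) \<longleftrightarrow> (\<exists>c. \<forall>T\<in>L. coord (\<Sum>a\<in>A. c a *\<^sub>R f a) T = coord x T)"
    unfolding spanned_on_def Bex_def span_image_explicit[OF assms] by blast
  then show ?thesis unfolding * by (simp only: eq_commute[of _ "coord x T" for T])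
qed

text \<open>Every product with the factor \<open>wedge basis_vec T\<close> is supported on supersets
  of \<open>T\<close>, which are nonfaces because \<open>L\<close> is closed under subsets.
  Conversely, in the basis expansion of an element vanishing on \<open>L\<close>, each nonzero term
  is a multiple of a generator.\<close>

lemma nonface_ideal_eq:
  assumes "simplicial_complex L"
  shows "nonface_ideal n L = {x \<in> exterior_upto n. \<forall>T\<in>L. coord x T = 0}"
proof -
  have sub: "coord x T = 0" if "x \<in> exterior_upto n" "\<not> T \<subseteq> {1..n}" for x T
    using that(1) unfolding exterior_upto_def
  proof (induction rule: span_induct_alt)
    case base
    then show ?case by (simp add: coord_simps)
  next
    case (step c x y)
    then obtain S where "S \<subseteq> {1..n}" "x = wedge basis_vec S" by auto
    moreover from this(1) have "finite S" by (rule finite_subset) simp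
    ultimately show ?case
      using step that(2) by (auto simp: coord_simps coord_wedge_basis_vec)
  qed
  have basis: "x = (\<Sum>S\<in>Pow {1..n}. coord x S *\<^sub>R wedge basis_vec S)"
    if "\<And>T. \<not> T \<subseteq> {1..n} \<Longrightarrow> coord x T = 0" for x
    using that by (intro exterior_expansion) auto
  have upto: "x \<in> exterior_upto n" if "\<And>T. \<not> T \<subseteq> {1..n} \<Longrightarrow> coord x T = 0" for x
  proof -
    have "(\<Sum>S\<in>Pow {1..n}. coord x S *\<^sub>R wedge basis_vec S) \<in> exterior_upto n"
      unfolding exterior_upto_def by (intro span_sum span_scale span_base imageI)
    then show ?thesis using basis[OF that] by simp
  qed
  show ?thesis
  proof (intro equalityI subsetI)
    fix z assume "z \<in> nonface_ideal n L"
    then have "z \<in> exterior_upto n \<and> (\<forall>T\<in>L. coord z T = 0)"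
      unfolding nonface_ideal_def
    proof (induction rule: span_induct_alt)
      case base
      then show ?case by (simp add: exterior_upto_def span_zero coord_simps)
    next
      case (step c z y)
      then obtain a T b where z: "z = a * wedge basis_vec T * b" "a \<in> exterior_upto n"
        "b \<in> exterior_upto n" "T \<subseteq> {1..n}" "T \<notin> L" by blast
      have "finite T" using z(4) by (rule finite_subset) simp
      have supp: "T \<subseteq> U \<and> U \<subseteq> {1..n}" if U: "coord z U \<noteq> 0" for U
      proof -
        obtain S where S: "S \<subseteq> U" "coord (a * wedge basis_vec T) S \<noteq> 0" "coord b (U - S) \<noteq> 0"
          using U unfolding z(1) by (rule coord_times_nonzeroD)
        obtain R where R: "R \<subseteq> S" "coord a R \<noteq> 0" "coord (wedge basis_vec T) (S - R) \<noteq> 0"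
          using S(2) by (rule coord_times_nonzeroD)
        have "T = S - R" using R(3) \<open>finite T\<close> by (simp add: coord_wedge_basis_vec split: if_splits)
        moreover have "R \<subseteq> {1..n}" "U - S \<subseteq> {1..n}"
          using sub[OF z(2)] sub[OF z(3)] R(2) S(3) by blast+
        ultimately show ?thesis using S(1) R(1) z(4) by blast
      qed
      have "z \<in> exterior_upto n" using supp by (intro upto) blast
      moreover have "coord z U = 0" if "U \<in> L" for U
        using supp[of U] that z(5) assms unfolding simplicial_complex_def by blast
      ultimately show ?case
        using step.IH unfolding exterior_upto_def by (auto simp: coord_simps intro: span_add span_scale)
    qed
    then show "z \<in> {x \<in> exterior_upto n. \<forall>T\<in>L. coord x T = 0}" by simp
  next
    fix z assume "z \<in> {x \<in> exterior_upto n. \<forall>T\<in>L. coord x T = 0}"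
    then have z: "z \<in> exterior_upto n" "\<And>T. T \<in> L \<Longrightarrow> coord z T = 0" by auto
    have one: "1 \<in> exterior_upto n"
      unfolding exterior_upto_def by (rule span_base) (auto intro!: image_eqI[of _ _ "{}"])
    have "coord z T *\<^sub>R wedge basis_vec T \<in> nonface_ideal n L" if "T \<subseteq> {1..n}" for T
    proof (cases "T \<in> L")
      case True
      then show ?thesis using z by (simp add: nonface_ideal_def span_zero)
    next
      case False
      have "wedge basis_vec T = 1 * wedge basis_vec T * 1" by simp
      then show ?thesis
        unfolding nonface_ideal_def using False one that by (intro span_scale span_base) blast
    qed
    then have "(\<Sum>T\<in>Pow {1..n}. coord z T *\<^sub>R wedge basis_vec T) \<in> nonface_ideal n L"
      unfolding nonface_ideal_def by (intro span_sum) auto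
    then show "z \<in> nonface_ideal n L"
      using basis[of z] sub[OF z(1)] by simp
  qed
qed

lemma wedge_row_vec_in_exterior_upto:
  assumes "finite S"
  shows "wedge (row_vec {1..n} a) S \<in> exterior_upto n"
proof -
  have "wedge (row_vec {1..n} a) S =
      (\<Sum>T\<in>Pow {1..n}. coord (wedge (row_vec {1..n} a) S) T *\<^sub>R wedge basis_vec T)"
    using coord_wedge_row_vec_supported[OF assms, of "{1..n}"]
    by (intro exterior_expansion) auto
  also have "\<dots> \<in> exterior_upto n"
    unfolding exterior_upto_def by (intro span_sum span_scale span_base) auto
  finally show ?thesis .
qed

lemma shift_labelled_eq_shift_rows:
  assumes "simplicial_complex L"
  shows "shift_labelled n \<alpha> L = shift_rows n (row_vec {1..n} \<alpha>) L"
proof -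
  let ?f = "row_vec {1..n} \<alpha>" and ?I = "nonface_ideal n L"
  have class_eq: "residue_class ?I x = residue_class ?I y \<longleftrightarrow> x - y \<in> ?I" for x y
  proof
    assume "residue_class ?I x = residue_class ?I y"
    moreover have "x \<in> residue_class ?I x"
      by (simp add: residue_class_def nonface_ideal_def span_zero)
    ultimately show "x - y \<in> ?I" by (auto simp: residue_class_def)
  next
    assume *: "x - y \<in> ?I"
    have "z - x \<in> ?I \<longleftrightarrow> z - y \<in> ?I" for z
    proof
      assume "z - x \<in> ?I"
      then have "(z - x) + (x - y) \<in> ?I" using * unfolding nonface_ideal_def by (rule span_add)
      then show "z - y \<in> ?I" by simp
    next
      assume "z - y \<in> ?I"
      then have "(z - y) - (x - y) \<in> ?I" using * unfolding nonface_ideal_def by (rule span_diff)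
      then show "z - x \<in> ?I" by simp
    qed
    then show "residue_class ?I x = residue_class ?I y" by (simp add: residue_class_def)
  qed
  have "residue_class ?I (wedge ?f S) \<in> residue_class ?I ` span (wedge ?f ` earlier n S) \<longleftrightarrow>
      spanned_on L (wedge ?f S) (wedge ?f ` earlier n S)" if "S \<subseteq> {1..n}" for S
  proof -
    have "finite S" using that by (rule finite_subset) simp
    have "span (wedge ?f ` earlier n S) \<subseteq> exterior_upto n"
      using wedge_row_vec_in_exterior_upto[of _ n \<alpha>] earlierD(1)
      unfolding exterior_upto_def by (intro span_minimal subspace_span image_subsetI) blast
    then have "wedge ?f S - y \<in> ?I \<longleftrightarrow> (\<forall>T\<in>L. coord y T = coord (wedge ?f S) T)"
      if "y \<in> span (wedge ?f ` earlier n S)" for y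
      using that wedge_row_vec_in_exterior_upto[OF \<open>finite S\<close>, of n \<alpha>]
      by (auto simp: nonface_ideal_eq[OF assms] exterior_upto_def coord_simps span_diff)
    then show ?thesis
      unfolding spanned_on_def image_iff class_eq by blast
  qed
  moreover have "{wedge ?f S' | S'. S' \<subseteq> {1..n} \<and> card S' = card S \<and> lex_less S' S} =
      wedge ?f ` earlier n S" for S
    by (auto simp: earlier_def)
  ultimately show ?thesis
    unfolding shift_labelled_def shift_rows_def generic_vec_eq_row_vec by auto
qed

lemma shift_rows_restrict_columns:
  assumes "finite Y" "X \<subseteq> Y" "L \<subseteq> Pow X"
  shows "shift_rows N (row_vec Y a) L = shift_rows N (row_vec X a) L"
proof -
  have X: "finite X" using assms finite_subset by blast
  have eq: "coord (wedge (row_vec Y a) S) T = coord (wedge (row_vec X a) S) T"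
    if "finite S" "T \<in> L" for S T
    using that assms X by (intro coord_wedge_row_vec_cong) auto
  have "spanned_on L (wedge (row_vec Y a) S) (wedge (row_vec Y a) ` earlier N S) \<longleftrightarrow>
      spanned_on L (wedge (row_vec X a) S) (wedge (row_vec X a) ` earlier N S)"
    if "S \<subseteq> {1..N}" for S
  proof -
    have S: "finite S" using that by (rule finite_subset) simp
    have "(\<Sum>U\<in>earlier N S. c U * coord (wedge (row_vec Y a) U) T) =
        (\<Sum>U\<in>earlier N S. c U * coord (wedge (row_vec X a) U) T)" if "T \<in> L" for c T
      using eq that earlierD(1) by (intro sum.cong) auto
    then show ?thesis
      using eq S by (simp add: spanned_on_image)
  qed
  then show ?thesis by (auto simp: shift_rows_def)
qed

text \<open>By \<open>wedge_in_span_initial\<close>, sets using later rows add nothing to the span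
  of the earlier wedges, and a set that is not contained in \<open>{1..p}\<close> is itself
  dependent on earlier ones.\<close>

lemma shift_rows_initial:
  assumes "anticommuting h" "p \<le> N" "\<And>i. i \<in> {1..N} \<Longrightarrow> h i \<in> span (h ` {1..p})"
  shows "shift_rows N h L = shift_rows p h L"
proof -
  let ?B = "\<lambda>S. {U. U \<subseteq> {1..p} \<and> card U = card S \<and> (U = S \<or> lex_less U S)}"
  have initial: "wedge h S \<in> span (wedge h ` ?B S)"
    if "S \<subseteq> {1..N}" for S
  proof (rule wedge_in_span_initial[OF assms(1)])
    show "finite S" using that by (rule finite_subset) simp
    show "1 \<le> i \<and> h i \<in> span (h ` {1..p})" if "i \<in> S" for i
      using that \<open>S \<subseteq> {1..N}\<close> assms(3)[of i] by auto
  qed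
  have span: "span (wedge h ` earlier N S) = span (wedge h ` earlier p S)" if "S \<subseteq> {1..N}" for S
  proof
    have "wedge h V \<in> span (wedge h ` earlier p S)" if V: "V \<in> earlier N S" for V
    proof -
      have "?B V \<subseteq> earlier p S"
      proof
        fix U assume U: "U \<in> ?B V"
        then have "finite U" using finite_subset[of U "{1..p}"] by simp
        moreover have "finite S" using \<open>S \<subseteq> {1..N}\<close> finite_subset[of S "{1..N}"] by simp
        ultimately have "lex_less U S"
          using U earlierD(1,4)[OF V] lex_less_trans[of U V S] by (cases "U = V") simp_all
        then show "U \<in> earlier p S" using U earlierD(3)[OF V] by (simp add: earlier_def)
      qed
      then have "span (wedge h ` ?B V) \<subseteq> span (wedge h ` earlier p S)"
        by (intro span_mono image_mono)
      then show ?thesis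
        using initial[OF earlierD(2)[OF V]] by (rule subsetD)
    qed
    then show "span (wedge h ` earlier N S) \<subseteq> span (wedge h ` earlier p S)"
      by (intro span_minimal subspace_span image_subsetI)
    show "span (wedge h ` earlier p S) \<subseteq> span (wedge h ` earlier N S)"
      using assms(2) by (intro span_mono image_mono) (auto simp: earlier_def)
  qed
  have N: "S \<subseteq> {1..p}" if "S \<in> shift_rows N h L" for S
  proof (rule ccontr)
    assume *: "\<not> S \<subseteq> {1..p}"
    have S: "S \<subseteq> {1..N}" using that by (simp add: shift_rows_def)
    \<comment> \<open>Since \<open>S\<close> is not contained in \<open>{1..p}\<close>, the
      alternative \<open>U = S\<close> drops out and only strictly earlier sets remain.\<close>
    have "{U. U \<subseteq> {1..p} \<and> card U = card S \<and> (U = S \<or> lex_less U S)} = earlier p S"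
      using * by (auto simp: earlier_def)
    then have "wedge h S \<in> span (wedge h ` earlier N S)"
      using initial[OF S] span[OF S] by simp
    then show False
      using that by (auto simp: shift_rows_def spanned_on_def)
  qed
  have iff: "S \<in> shift_rows N h L \<longleftrightarrow> S \<in> shift_rows p h L" if "S \<subseteq> {1..p}" for S
  proof -
    have "S \<subseteq> {1..N}" using that assms(2) by auto
    then show ?thesis using that by (simp add: shift_rows_def spanned_on_def span)
  qed
  have p: "S \<subseteq> {1..p}" if "S \<in> shift_rows p h L" for S
    using that by (simp add: shift_rows_def)
  show ?thesis
    using N p iff by (intro set_eqI) metis
qed

text \<open>The linear systems defining the two shiftings have minors as coefficients. Solvability
  transfers between generic points, and relabelling the columns only changes signs of whole
  equations.\<close>

lemma shift_rows_generic:
  assumes "finite X" "L \<subseteq> Pow X" "inj_on \<theta> X"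
    and "generic_point ({1..p} \<times> X) (\<lambda>(i, j). a i j)"
    and "generic_point ({1..p} \<times> X) (\<lambda>(i, j). b i (\<theta> j))"
  shows "shift_rows p (row_vec X a) L = shift_rows p (row_vec (\<theta> ` X) b) ((`) \<theta> ` L)"
proof -
  let ?g = "\<lambda>x S T. coord (wedge (row_vec X (\<lambda>i j. x (i, j))) S) T"
  let ?a = "\<lambda>(i, j). a i j" and ?b = "\<lambda>(i, j). b i (\<theta> j)"
  have poly: "(\<lambda>x. ?g x S T) \<in> polyfun ({1..p} \<times> X)" if "S \<subseteq> {1..p}" for S T
  proof -
    have "finite S" using that finite_subset[of S "{1..p}"] by simp
    then show ?thesis
      using that assms(1) by (intro polyfun_mono[OF coord_wedge_row_vec_polyfun]) auto
  qed
  have relabel: "coord (wedge (row_vec (\<theta> ` X) b) S) (\<theta> ` T) = relabel_sign \<theta> T * ?g ?b S T"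
    if "finite S" "T \<in> L" for S T
    using that assms(1-3) by (intro coord_wedge_relabel) (auto intro: inj_on_subset)
  have "spanned_on L (wedge (row_vec X a) S) (wedge (row_vec X a) ` earlier p S) \<longleftrightarrow>
      spanned_on ((`) \<theta> ` L) (wedge (row_vec (\<theta> ` X) b) S) (wedge (row_vec (\<theta> ` X) b) ` earlier p S)"
    if S: "S \<subseteq> {1..p}" for S
  proof -
    have finS: "finite S" using S finite_subset[of S "{1..p}"] by simp
    let ?P = "\<lambda>x. \<exists>c. \<forall>T\<in>L. ?g x S T = (\<Sum>U\<in>earlier p S. c U * ?g x U T)"
    have transfer: "?P y" if "?P x"
      "generic_point ({1..p} \<times> X) x" "generic_point ({1..p} \<times> X) y" for x y
    proof -
      from that(1) obtain c where c: "\<forall>T\<in>L. ?g x S T = (\<Sum>U\<in>earlier p S. c U * ?g x U T)"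
        by (rule exE)
      show ?thesis
      proof (rule span_transfer_polyfun[where I = "{1..p} \<times> X" and x = x and c = c])
        show "F x = 0 \<longleftrightarrow> F y = 0" if "F \<in> polyfun ({1..p} \<times> X)" for F
          using generic_point_same_zeros[OF \<open>generic_point _ x\<close> \<open>generic_point _ y\<close> that] .
      qed (use c poly[OF S] poly[OF earlierD(2)] in \<open>simp_all only: finite_earlier\<close>)
    qed
    have "spanned_on L (wedge (row_vec X a) S) (wedge (row_vec X a) ` earlier p S) \<longleftrightarrow> ?P ?a"
      by (simp add: spanned_on_image)
    also have "\<dots> \<longleftrightarrow> ?P ?b"
      using transfer[OF _ assms(4,5)] transfer[OF _ assms(5,4)] by (rule iffI)
    also have "\<dots> \<longleftrightarrow> spanned_on ((`) \<theta> ` L) (wedge (row_vec (\<theta> ` X) b) S)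
        (wedge (row_vec (\<theta> ` X) b) ` earlier p S)"
    proof -
      \<comment> \<open>The sign depends on \<open>T\<close> alone, so it cancels from the equation
        belonging to \<open>T\<close>.\<close>
      have "(\<Sum>U\<in>earlier p S. c U * coord (wedge (row_vec (\<theta> ` X) b) U) (\<theta> ` T)) =
          relabel_sign \<theta> T * (\<Sum>U\<in>earlier p S. c U * ?g ?b U T)" if "T \<in> L" for c T
        using relabel that earlierD(1) unfolding sum_distrib_left by (intro sum.cong) auto
      then show ?thesis
        using relabel finS by (simp add: spanned_on_image)
    qed
    finally show ?thesis .
  qed
  then show ?thesis by (auto simp: shift_rows_def)
qed

text \<open>Both sides are first cut down to \<open>card X\<close> rows, where the two matrices have
  the same shape and can be compared.\<close>

lemma shift_rows_independent_of_choices: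
  assumes X: "finite X" "L \<subseteq> Pow X" "inj_on \<theta> X" "card X \<le> N" "card X \<le> M"
    and a: "generic_point ({1..N} \<times> X) (\<lambda>(i, j). a i j)"
    and b: "generic_point ({1..M} \<times> X) (\<lambda>(i, j). b i (\<theta> j))"
  shows "shift_rows N (row_vec X a) L = shift_rows M (row_vec (\<theta> ` X) b) ((`) \<theta> ` L)"
proof -
  let ?p = "card X"
  have a': "generic_point ({1..?p} \<times> X) (\<lambda>(i, j). a i j)"
    using X(4) by (intro generic_point_subset[OF a]) auto
  have b': "generic_point ({1..?p} \<times> X) (\<lambda>(i, j). b i (\<theta> j))"
    using X(5) by (intro generic_point_subset[OF b]) auto
  \<comment> \<open>Genericity is moved back along the inverse of \<open>\<theta>\<close>, so that
    the row span lemma applies to the columns in the image of \<open>X\<close>.\<close>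
  have "generic_point ({1..?p} \<times> \<theta> ` X) (\<lambda>(i, j). b i j)"
  proof -
    have "generic_point ({1..?p} \<times> \<theta> ` X)
        (\<lambda>k. (\<lambda>(i, j). b i (\<theta> j)) (fst k, the_inv_into X \<theta> (snd k)))"
    proof (rule generic_point_compose[OF b'])
      fix k assume "k \<in> {1..?p} \<times> \<theta> ` X"
      then show "(\<lambda>x. x (fst k, the_inv_into X \<theta> (snd k))) \<in> polyfun ({1..?p} \<times> X)"
        using X(3) by (intro polyfun.var) (auto simp: the_inv_into_f_f)
    next
      fix y :: "nat \<times> nat \<Rightarrow> real"
      show "\<exists>z. \<forall>k\<in>{1..?p} \<times> \<theta> ` X. z (fst k, the_inv_into X \<theta> (snd k)) = y k"
        using X(3) by (intro exI[of _ "\<lambda>(i, j). y (i, \<theta> j)"]) (auto simp: the_inv_into_f_f)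
    qed
    then show ?thesis
    proof (rule generic_point_cong)
      fix k assume "k \<in> {1..?p} \<times> \<theta> ` X"
      then show "(\<lambda>(i, j). b i (\<theta> j)) (fst k, the_inv_into X \<theta> (snd k)) = (\<lambda>(i, j). b i j) k"
        using X(3) by (auto simp: f_the_inv_into_f)
    qed
  qed
  then have "row_vec (\<theta> ` X) b i \<in> span (row_vec (\<theta> ` X) b ` {1..?p})" for i
    using X by (intro generic_rows_span) (auto simp: card_image)
  then have "shift_rows M (row_vec (\<theta> ` X) b) ((`) \<theta> ` L) = shift_rows ?p (row_vec (\<theta> ` X) b) ((`) \<theta> ` L)"
    using X by (intro shift_rows_initial anticommuting_row_vec)
  moreover have "shift_rows N (row_vec X a) L = shift_rows ?p (row_vec X a) L"
    using X generic_rows_span[OF X(1) refl a'] by (intro shift_rows_initial anticommuting_row_vec)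
  ultimately show ?thesis
    using shift_rows_generic[OF X(1-3) a' b'] by simp
qed

section \<open>Links in near cones\<close>

lemma wedge_image_Suc:
  assumes "finite S"
  shows "wedge g (Suc ` S) = wedge (\<lambda>i. g (Suc i)) S"
  using assms
proof (induction rule: finite_linorder_min_induct)
  case (insert s S)
  have "wedge g (insert (Suc s) (Suc ` S)) = g (Suc s) * wedge g (Suc ` S)"
    using insert.hyps by (intro wedge_insert_min) auto
  moreover have "wedge (\<lambda>i. g (Suc i)) (insert s S) = g (Suc s) * wedge (\<lambda>i. g (Suc i)) S"
    using insert.hyps by (intro wedge_insert_min) auto
  ultimately show ?case using insert.IH by simp
qed simp

text \<open>A row operation under the factor \<open>f\<close>: the multiples of \<open>f\<close> die
  because \<open>f * f = 0\<close>, and each of the \<open>card S\<close> factors contributes one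
  \<open>c\<close>.\<close>

lemma times_wedge_modulo:
  assumes "finite S" "f * f = 0" "\<And>i. f * g i = - (g i * f)"
  shows "f * wedge (\<lambda>i. c *\<^sub>R g i - d i *\<^sub>R f) S = c ^ card S *\<^sub>R (f * wedge g S)"
  using assms(1)
proof (induction rule: finite_linorder_min_induct)
  case (insert s S)
  let ?h = "\<lambda>i. c *\<^sub>R g i - d i *\<^sub>R f"
  have w: "wedge k (insert s S) = k s * wedge k S" for k
    using insert.hyps by (intro wedge_insert_min) auto
  have "s \<notin> S" using insert.hyps by auto
  have "f * (?h s * x) = - (c *\<^sub>R (g s * (f * x)))" for x
  proof -
    have "f * ?h s = - (c *\<^sub>R (g s * f))"
      using assms(2,3) by (simp add: right_diff_distrib)
    then show ?thesis by (metis mult.assoc mult_minus_left mult_scaleR_left)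
  qed
  then have "f * wedge ?h (insert s S) = - (c *\<^sub>R (g s * (c ^ card S *\<^sub>R (f * wedge g S))))"
    unfolding w insert.IH[symmetric] .
  also have "\<dots> = c ^ Suc (card S) *\<^sub>R - (g s * (f * wedge g S))"
    by simp
  also have "- (g s * (f * wedge g S)) = f * wedge g (insert s S)"
    unfolding w using assms(3)[of s] by (metis mult.assoc mult_minus_left)
  finally show ?case
    using insert.hyps \<open>s \<notin> S\<close> by simp
qed simp

text \<open>A set of positive integers that precedes a set containing 1 contains 1 itself; on the
  remaining elements, the shift by one preserves the order.\<close>

lemma earlier_insert_1:
  assumes "T \<subseteq> {1..n - 1}" "n \<ge> 1"
  shows "earlier n (insert 1 (Suc ` T)) = (\<lambda>U. insert 1 (Suc ` U)) ` earlier (n - 1) T"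
proof -
  have finT: "finite T" using assms(1) by (rule finite_subset) simp
  have card: "card (insert 1 (Suc ` U)) = Suc (card U)" if "finite U" "U \<subseteq> {1..}" for U
    using that by (subst card_insert_disjoint) (auto simp: card_image)
  have lex: "lex_less (insert 1 (Suc ` U)) (insert 1 (Suc ` T)) \<longleftrightarrow> lex_less U T"
    if U: "U \<subseteq> {1..n - 1}" for U
  proof -
    have finU: "finite U" using U by (rule finite_subset) simp
    have 0: "0 \<notin> U" "0 \<notin> T" using U assms(1) by auto
    have "(\<exists>x. x \<in> insert 1 (Suc ` U) \<and> x \<notin> insert 1 (Suc ` T) \<and>
        (\<forall>y<x. y \<in> insert 1 (Suc ` U) \<longleftrightarrow> y \<in> insert 1 (Suc ` T))) \<longleftrightarrow>
      (\<exists>x. x \<in> U \<and> x \<notin> T \<and> (\<forall>y<x. y \<in> U \<longleftrightarrow> y \<in> T))"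
    proof
      assume "\<exists>x. x \<in> insert 1 (Suc ` U) \<and> x \<notin> insert 1 (Suc ` T) \<and>
        (\<forall>y<x. y \<in> insert 1 (Suc ` U) \<longleftrightarrow> y \<in> insert 1 (Suc ` T))"
      then obtain x where x: "x \<in> U" "Suc x \<notin> insert 1 (Suc ` T)"
        "\<forall>y<Suc x. y \<in> insert 1 (Suc ` U) \<longleftrightarrow> y \<in> insert 1 (Suc ` T)"
        using 0 by (elim exE conjE insertE imageE) auto
      have "y \<in> U \<longleftrightarrow> y \<in> T" if "y < x" for y
        using x(3)[rule_format, of "Suc y"] that 0 by (cases "y = 0") auto
      then show "\<exists>x. x \<in> U \<and> x \<notin> T \<and> (\<forall>y<x. y \<in> U \<longleftrightarrow> y \<in> T)"
        using x by auto
    next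
      assume "\<exists>x. x \<in> U \<and> x \<notin> T \<and> (\<forall>y<x. y \<in> U \<longleftrightarrow> y \<in> T)"
      then obtain x where x: "x \<in> U" "x \<notin> T" "\<And>y. y < x \<Longrightarrow> y \<in> U \<longleftrightarrow> y \<in> T" by auto
      have "x \<noteq> 0" using x(1) 0 by metis
      moreover have "y \<in> insert 1 (Suc ` U) \<longleftrightarrow> y \<in> insert 1 (Suc ` T)" if "y < Suc x" for y
        using that x(3)[of "y - 1"] by (cases y) (auto simp: image_iff)
      ultimately show "\<exists>x. x \<in> insert 1 (Suc ` U) \<and> x \<notin> insert 1 (Suc ` T) \<and>
          (\<forall>y<x. y \<in> insert 1 (Suc ` U) \<longleftrightarrow> y \<in> insert 1 (Suc ` T))"
        using x(1,2) by (intro exI[of _ "Suc x"]) auto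
    qed
    moreover have "card (insert 1 (Suc ` U)) = card (insert 1 (Suc ` T)) \<longleftrightarrow> card U = card T"
      using card[of U] card[of T] finU finT U assms(1) by (simp add: subset_iff)
    ultimately show ?thesis
      using finU finT by (simp only: lex_less_iff finite_insert finite_imageI)
  qed
  show ?thesis
  proof (intro equalityI subsetI)
    fix V assume V: "V \<in> earlier n (insert 1 (Suc ` T))"
    \<comment> \<open>The first difference \<open>x\<close> is not 1 and \<open>V\<close> has only
      positive elements, so the two sets agree at 1.\<close>
    have "1 \<in> V"
    proof -
      obtain x where "x \<in> V" "x \<notin> insert 1 (Suc ` T)" "\<forall>y<x. y \<in> V \<longleftrightarrow> y \<in> insert 1 (Suc ` T)"
        using earlierD(1,4)[OF V] finT by (auto simp: lex_less_iff)
      moreover from this have "1 < x" using earlierD(2)[OF V] by force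
      ultimately show ?thesis by simp
    qed
    define U where "U = {u. Suc u \<in> V \<and> u \<ge> 1}"
    have VU: "V = insert 1 (Suc ` U)"
    proof (intro equalityI subsetI)
      fix x assume x: "x \<in> V"
      then have "x \<ge> 1" using earlierD(2)[OF V] by auto
      then show "x \<in> insert 1 (Suc ` U)"
        using x by (cases "x = 1") (auto simp: U_def intro!: image_eqI[of _ _ "x - 1"])
    qed (use \<open>1 \<in> V\<close> in \<open>auto simp: U_def\<close>)
    have U: "U \<subseteq> {1..n - 1}"
      using earlierD(2)[OF V] by (auto simp: U_def)
    have "lex_less U T" using earlierD(4)[OF V] lex[OF U] VU by simp
    then have "U \<in> earlier (n - 1) T"
      using U by (simp add: earlier_def lex_less_def)
    then show "V \<in> (\<lambda>U. insert 1 (Suc ` U)) ` earlier (n - 1) T"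
      using VU by blast
  next
    fix V assume "V \<in> (\<lambda>U. insert 1 (Suc ` U)) ` earlier (n - 1) T"
    then obtain U where U: "U \<in> earlier (n - 1) T" "V = insert 1 (Suc ` U)" by blast
    have "lex_less V (insert 1 (Suc ` T))" using lex[OF earlierD(2)[OF U(1)]] earlierD(4)[OF U(1)] U(2) by simp
    moreover have "V \<subseteq> {1..n}" using earlierD(2)[OF U(1)] U(2) assms(2) by (auto dest!: subsetD)
    ultimately show "V \<in> earlier n (insert 1 (Suc ` T))"
      by (simp add: earlier_def lex_less_def)
  qed
qed

text \<open>The coordinate of the product at \<open>insert w W\<close> is a nonzero multiple of that
  of \<open>z\<close> at \<open>W\<close>. Conversely, removing any element from a face leaves a set
  that contains \<open>w\<close>, where \<open>z\<close> vanishes, or a face of the link.\<close>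

lemma near_cone_annihilator:
  assumes L: "simplicial_complex L" "L \<subseteq> Pow {1..n}" "near_cone w L" and "a i w \<noteq> 0"
    and z: "\<And>T. coord z T \<noteq> 0 \<Longrightarrow> w \<notin> T"
  shows "(\<forall>T\<in>L. coord (row_vec {1..n} a i * z) T = 0) \<longleftrightarrow> (\<forall>W\<in>link w L. coord z W = 0)"
proof -
  have down: "T \<in> L" if "S \<in> L" "T \<subseteq> S" for S T
    using that L(1) unfolding simplicial_complex_def by blast
  have coord: "coord (row_vec {1..n} a i * z) T =
      (\<Sum>t\<in>T. (-1) ^ card {u \<in> T. u < t} * a i t * coord z (T - {t}))" if "T \<in> L" for T
    using that L(2) by (subst coord_row_vec_times) (auto simp: inf_absorb1)
  show ?thesis
  proof (intro iffI ballI)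
    fix W assume *: "\<forall>T\<in>L. coord (row_vec {1..n} a i * z) T = 0" and W: "W \<in> link w L"
    let ?T = "insert w W"
    have T: "?T \<in> L" "w \<notin> W" using W by (auto simp: link_def)
    have "finite ?T" using T(1) L(1) unfolding simplicial_complex_def by blast
    have "0 = (\<Sum>t\<in>?T. (-1) ^ card {u \<in> ?T. u < t} * a i t * coord z (?T - {t}))"
      using * coord[OF T(1)] T(1) by simp
    \<comment> \<open>Removing any element other than \<open>w\<close> leaves a set containing
      \<open>w\<close>, where \<open>z\<close> vanishes.\<close>
    also have "\<dots> = (\<Sum>t\<in>{w}. (-1) ^ card {u \<in> ?T. u < t} * a i t * coord z (?T - {t}))"
      using \<open>finite ?T\<close> z by (intro sum.mono_neutral_right) auto
    also have "\<dots> = (-1) ^ card {u \<in> ?T. u < w} * a i w * coord z W"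
      using T(2) by simp
    finally show "coord z W = 0" using assms(4) by simp
  next
    fix T assume *: "\<forall>W\<in>link w L. coord z W = 0" and T: "T \<in> L"
    have "coord z (T - {t}) = 0" if t: "t \<in> T" for t
    proof (cases "w \<in> T - {t}")
      case True
      then show ?thesis using z by blast
    next
      case False
      \<comment> \<open>For \<open>t = w\<close> this set is \<open>T\<close> itself; otherwise it
        is the exchange granted by the near cone property.\<close>
      have "(T - {t}) \<union> {w} \<in> L"
      proof (cases "t = w")
        case True
        then show ?thesis using T t by (simp add: insert_absorb)
      next
        case False
        then have "(T - {t}) \<union> {w} = (T \<union> {w}) - {t}" by auto
        then show ?thesis using L(3) T t unfolding near_cone_def by simp
      qed
      moreover have "T - {t} \<in> L" using T by (rule down) auto
      ultimately have "T - {t} \<in> link w L" using False by (simp add: link_def)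
      then show ?thesis using * by blast
    qed
    then show "coord (row_vec {1..n} a i * z) T = 0"
      unfolding coord[OF T] by (intro sum.neutral) simp
  qed
qed

text \<open>\<open>earlier_insert_1\<close> reduces the condition to products with
  \<open>?f 1\<close>, \<open>times_wedge_modulo\<close> rewrites them through the eliminated rows,
  and \<open>near_cone_annihilator\<close> removes the factor \<open>?f 1\<close>.\<close>

lemma insert_1_in_shift_rows_iff:
  assumes L: "simplicial_complex L" "L \<subseteq> Pow {1..n}" "near_cone w L" and a: "a 1 w \<noteq> 0"
    and T: "T \<subseteq> {1..n - 1}" and n: "n \<ge> 1" and w: "w \<in> {1..n}"
  shows "insert 1 (Suc ` T) \<in> shift_rows n (row_vec {1..n} a) L \<longleftrightarrow>
    T \<in> shift_rows (n - 1)
      (row_vec ({1..n} - {w}) (\<lambda>i j. a 1 w * a (Suc i) j - a (Suc i) w * a 1 j)) (link w L)"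
proof -
  let ?f = "row_vec {1..n} a"
  let ?h = "row_vec ({1..n} - {w}) (\<lambda>i j. a 1 w * a (Suc i) j - a (Suc i) w * a 1 j)"
  have h: "?h = (\<lambda>i. a 1 w *\<^sub>R ?f (Suc i) - a (Suc i) w *\<^sub>R ?f 1)"
  proof
    fix i
    have "a 1 w *\<^sub>R ?f (Suc i) - a (Suc i) w *\<^sub>R ?f 1 =
        (\<Sum>j\<in>{1..n}. (a 1 w * a (Suc i) j - a (Suc i) w * a 1 j) *\<^sub>R basis_vec j)"
      by (simp add: row_vec_def scaleR_sum_right scaleR_diff_left sum_subtractf)
    also have "\<dots> = ?h i"
      unfolding row_vec_def by (intro sum.mono_neutral_right) auto
    finally show "?h i = a 1 w *\<^sub>R ?f (Suc i) - a (Suc i) w *\<^sub>R ?f 1" ..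
  qed
  have f: "wedge ?f (insert 1 (Suc ` U)) = (inverse (a 1 w ^ card U)) *\<^sub>R (?f 1 * wedge ?h U)"
    if U: "U \<subseteq> {1..n - 1}" for U
  proof -
    have fin: "finite U" using U by (rule finite_subset) simp
    have "?f 1 * wedge ?h U = a 1 w ^ card U *\<^sub>R (?f 1 * wedge (\<lambda>i. ?f (Suc i)) U)"
      unfolding h using fin
    proof (rule times_wedge_modulo)
      show "?f 1 * ?f 1 = 0" by (intro anticommuting_square anticommuting_row_vec)
      show "?f 1 * ?f (Suc i) = - (?f (Suc i) * ?f 1)" for i
        using anticommuting_row_vec[of "{1..n}" a] unfolding anticommuting_def by blast
    qed
    moreover have "wedge ?f (insert 1 (Suc ` U)) = ?f 1 * wedge ?f (Suc ` U)"
      using fin U by (intro wedge_insert_min) auto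
    ultimately show ?thesis using a wedge_image_Suc[OF fin] by simp
  qed
  have inj: "inj_on (\<lambda>U. insert 1 (Suc ` U)) (earlier (n - 1) T)"
  proof (rule inj_onI)
    fix U V assume UV: "U \<in> earlier (n - 1) T" "V \<in> earlier (n - 1) T"
      and eq: "insert 1 (Suc ` U) = insert 1 (Suc ` V)"
    have "1 \<notin> Suc ` U" "1 \<notin> Suc ` V"
      using earlierD(2)[OF UV(1)] earlierD(2)[OF UV(2)] by auto
    then have "Suc ` U = Suc ` V" using eq by (metis insert_ident)
    then show "U = V" by (simp add: inj_image_eq_iff)
  qed
  have finT: "finite T" using T by (rule finite_subset) simp
  \<comment> \<open>All sets in \<open>earlier (n - 1) T\<close> have the cardinality of
    \<open>T\<close>, so a single factor \<open>k\<close> is common to the whole relation.\<close>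
  define k where "k = inverse (a 1 w ^ card T)"
  have k: "k \<noteq> 0" using a by (simp add: k_def)
  have "spanned_on L (wedge ?f (insert 1 (Suc ` T))) (wedge ?f ` earlier n (insert 1 (Suc ` T))) \<longleftrightarrow>
      (\<exists>c. \<forall>W\<in>L. coord (wedge ?f (insert 1 (Suc ` T))) W =
        (\<Sum>U\<in>earlier (n - 1) T. c U * coord (wedge ?f (insert 1 (Suc ` U))) W))"
    unfolding earlier_insert_1[OF T n] image_image by (rule spanned_on_image) simp
  also have "\<dots> \<longleftrightarrow> (\<exists>c. \<forall>W\<in>L. coord (?f 1 * (wedge ?h T - (\<Sum>U\<in>earlier (n - 1) T. c U *\<^sub>R wedge ?h U))) W = 0)"
  proof -
    have "coord (wedge ?f (insert 1 (Suc ` T))) W =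
        (\<Sum>U\<in>earlier (n - 1) T. c U * coord (wedge ?f (insert 1 (Suc ` U))) W) \<longleftrightarrow>
      coord (?f 1 * (wedge ?h T - (\<Sum>U\<in>earlier (n - 1) T. c U *\<^sub>R wedge ?h U))) W = 0" for c W
    proof -
      have "(\<Sum>U\<in>earlier (n - 1) T. c U * coord (wedge ?f (insert 1 (Suc ` U))) W) =
          k * (\<Sum>U\<in>earlier (n - 1) T. c U * coord (?f 1 * wedge ?h U) W)"
        unfolding sum_distrib_left
      proof (rule sum.cong)
        fix U assume U: "U \<in> earlier (n - 1) T"
        show "c U * coord (wedge ?f (insert 1 (Suc ` U))) W = k * (c U * coord (?f 1 * wedge ?h U) W)"
          unfolding f[OF earlierD(2)[OF U]] earlierD(3)[OF U] k_def[symmetric] scaleR_exterior.rep_eq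
          by simp
      qed simp
      moreover have "coord (wedge ?f (insert 1 (Suc ` T))) W = k * coord (?f 1 * wedge ?h T) W"
        unfolding f[OF T] k_def[symmetric] scaleR_exterior.rep_eq ..
      moreover have "coord (?f 1 * (wedge ?h T - (\<Sum>U\<in>earlier (n - 1) T. c U *\<^sub>R wedge ?h U))) W =
          coord (?f 1 * wedge ?h T) W - (\<Sum>U\<in>earlier (n - 1) T. c U * coord (?f 1 * wedge ?h U) W)"
        unfolding right_diff_distrib sum_distrib_left minus_exterior.rep_eq coord_sum
          mult_scaleR_right scaleR_exterior.rep_eq ..
      ultimately show ?thesis using k by simp
    qed
    then show ?thesis by simp
  qed
  also have "\<dots> \<longleftrightarrow> (\<exists>c. \<forall>W\<in>link w L. coord (wedge ?h T - (\<Sum>U\<in>earlier (n - 1) T. c U *\<^sub>R wedge ?h U)) W = 0)"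
  proof -
    have w_free: "coord (wedge ?h U) W = 0" if "finite U" "w \<in> W" for U W
      using coord_wedge_row_vec_supported[OF that(1), of "{1..n} - {w}"] that(2) by blast
    \<comment> \<open>The rows \<open>?h\<close> avoid \<open>w\<close>, so the whole combination
      does, as \<open>near_cone_annihilator\<close> requires.\<close>
    have "coord (wedge ?h T - (\<Sum>U\<in>earlier (n - 1) T. c U *\<^sub>R wedge ?h U)) W = 0" if "w \<in> W" for c W
      using w_free[OF finT that] w_free[OF earlierD(1) that]
      by (simp add: minus_exterior.rep_eq coord_sum scaleR_exterior.rep_eq)
    then show ?thesis
      using near_cone_annihilator[OF L, of a 1, OF a] by meson
  qed
  also have "\<dots> \<longleftrightarrow> spanned_on (link w L) (wedge ?h T) (wedge ?h ` earlier (n - 1) T)"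
    by (simp add: spanned_on_image coord_sum coord_simps)
  finally have "spanned_on L (wedge ?f (insert 1 (Suc ` T))) (wedge ?f ` earlier n (insert 1 (Suc ` T))) \<longleftrightarrow>
    spanned_on (link w L) (wedge ?h T) (wedge ?h ` earlier (n - 1) T)" .
  moreover have "insert 1 (Suc ` T) \<subseteq> {1..n}" using T n by (auto dest!: subsetD)
  ultimately show ?thesis using T by (simp add: shift_rows_def)
qed

section \<open>Links and relabellings of simplicial complexes\<close>

lemma simplicial_complex_down:
  "simplicial_complex K \<Longrightarrow> S \<in> K \<Longrightarrow> T \<subseteq> S \<Longrightarrow> T \<in> K"
  unfolding simplicial_complex_def by blast

lemma vertices_link_subset:
  assumes "simplicial_complex K"
  shows "vertices (link v K) \<subseteq> vertices K - {v}" "link v K \<subseteq> Pow (vertices (link v K))"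
proof -
  show "vertices (link v K) \<subseteq> vertices K - {v}"
    by (auto simp: vertices_def link_def)
  show "link v K \<subseteq> Pow (vertices (link v K))"
  proof
    fix T assume T: "T \<in> link v K"
    have "{t} \<in> link v K" if t: "t \<in> T" for t
    proof -
      have "T \<in> K" "T \<union> {v} \<in> K" using T by (auto simp: link_def)
      then have "{t} \<in> K" "{t} \<union> {v} \<in> K"
        using simplicial_complex_down[OF assms] t by (metis Un_upper1 Un_mono empty_subsetI insert_subset subset_refl)+
      moreover have "v \<noteq> t" using T t by (auto simp: link_def)
      ultimately show ?thesis by (simp add: link_def)
    qed
    then show "T \<in> Pow (vertices (link v K))" by (auto simp: vertices_def)
  qed
qed

lemma simplicial_complex_subset_vertices:
  assumes "simplicial_complex K"
  shows "K \<subseteq> Pow (vertices K)"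
proof
  fix S assume "S \<in> K"
  then have "{s} \<in> K" if "s \<in> S" for s
    using simplicial_complex_down[OF assms, of S "{s}"] that by simp
  then show "S \<in> Pow (vertices K)" by (auto simp: vertices_def)
qed

lemma simplicial_complex_link:
  assumes "simplicial_complex K" "v \<in> vertices K"
  shows "simplicial_complex (link v K)"
proof -
  note down = simplicial_complex_down[OF assms(1)]
  have "T \<in> link v K" if "S \<in> link v K" "T \<subseteq> S" for S T
    using that down[of S T] down[of "S \<union> {v}" "T \<union> {v}"] by (auto simp: link_def)
  moreover have "{} \<in> link v K"
    using assms by (simp add: link_def vertices_def simplicial_complex_def)
  moreover have "link v K \<subseteq> K" by (auto simp: link_def)
  ultimately show ?thesis
    using assms(1) unfolding simplicial_complex_def by (meson finite_subset subsetD)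
qed

lemma simplicial_complex_image:
  assumes "simplicial_complex K"
  shows "simplicial_complex ((`) \<phi> ` K)"
proof -
  have "\<forall>S\<in>(`) \<phi> ` K. \<forall>T\<subseteq>S. T \<in> (`) \<phi> ` K"
  proof (intro ballI allI impI)
    fix S' T assume "S' \<in> (`) \<phi> ` K" "T \<subseteq> S'"
    then obtain S where S: "S \<in> K" "T \<subseteq> \<phi> ` S" by blast
    from S(2) obtain R where R: "R \<subseteq> S" "T = \<phi> ` R" by (rule subset_imageE)
    have "R \<in> K" using assms S(1) R(1) by (rule simplicial_complex_down)
    then show "T \<in> (`) \<phi> ` K" using R(2) by blast
  qed
  moreover have "{} \<in> (`) \<phi> ` K" "finite ((`) \<phi> ` K)" "\<forall>S\<in>(`) \<phi> ` K. finite S"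
    using assms by (auto simp: simplicial_complex_def)
  ultimately show ?thesis
    unfolding simplicial_complex_def by (intro conjI)
qed

text \<open>Injectivity on the vertices lets the removal of a vertex commute with taking
  images.\<close>

lemma near_cone_image:
  assumes "simplicial_complex K" "near_cone v K" "inj_on \<phi> (vertices K)"
  shows "near_cone (\<phi> v) ((`) \<phi> ` K)"
  unfolding near_cone_def
proof (intro conjI ballI)
  have v: "v \<in> vertices K" using assms(2) by (simp add: near_cone_def)
  then show "\<phi> v \<in> vertices ((`) \<phi> ` K)"
    by (auto simp: vertices_def intro!: image_eqI[of _ _ "{v}"])
  fix S' j' assume "S' \<in> (`) \<phi> ` K" "j' \<in> S'"
  then obtain S j where S: "S \<in> K" "S' = \<phi> ` S" "j \<in> S" "j' = \<phi> j" by auto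
  have sub: "S \<union> {v} \<subseteq> vertices K" "{j} \<subseteq> vertices K"
    using S v simplicial_complex_subset_vertices[OF assms(1)] by auto
  have "S' \<union> {\<phi> v} - {j'} = \<phi> ` (S \<union> {v}) - \<phi> ` {j}"
    using S by auto
  also have "\<dots> = \<phi> ` (S \<union> {v} - {j})"
    by (rule inj_on_image_set_diff[OF assms(3), symmetric]) (use sub in auto)
  finally show "S' \<union> {\<phi> v} - {j'} \<in> (`) \<phi> ` K"
    using S assms(2) by (simp add: near_cone_def)
qed

lemma link_image:
  assumes "simplicial_complex K" "v \<in> vertices K" "inj_on \<phi> (vertices K)"
  shows "link (\<phi> v) ((`) \<phi> ` K) = (`) \<phi> ` link v K"
proof -
  have sub: "S \<subseteq> vertices K" if "S \<in> K" for S
    using that simplicial_complex_subset_vertices[OF assms(1)] by auto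
  have mem: "\<phi> ` S \<in> (`) \<phi> ` K \<longleftrightarrow> S \<in> K" if "S \<subseteq> vertices K" for S
  proof
    assume "\<phi> ` S \<in> (`) \<phi> ` K"
    then obtain T where T: "T \<in> K" "\<phi> ` S = \<phi> ` T" by blast
    then have "S = T" using inj_on_image_eq_iff[OF assms(3) that sub] by simp
    then show "S \<in> K" using T(1) by simp
  qed simp
  have v: "\<phi> v \<in> \<phi> ` S \<longleftrightarrow> v \<in> S" if "S \<in> K" for S
    using sub[OF that] assms(2,3) by (auto dest: inj_onD)
  have "\<phi> ` S \<union> {\<phi> v} \<in> (`) \<phi> ` K \<longleftrightarrow> S \<union> {v} \<in> K" if "S \<in> K" for S
    using mem[of "S \<union> {v}"] sub[OF that] assms(2) by simp
  then show ?thesis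
    unfolding link_def using v by auto
qed

section \<open>Generic matrices and their elimination\<close>

lemma generic_point_if_generic:
  "generic n \<alpha> \<Longrightarrow> generic_point ({1..n} \<times> {1..n}) (\<lambda>(i, j). \<alpha> i j)"
  unfolding generic_def by (rule algebraically_independent_imp_generic_point)

lemma generic_nonzero:
  assumes "generic n \<alpha>" "i \<in> {1..n}" "j \<in> {1..n}"
  shows "\<alpha> i j \<noteq> 0"
proof
  assume "\<alpha> i j = 0"
  moreover have "(\<lambda>x. x (i, j)) \<in> polyfun ({1..n} \<times> {1..n})"
    using assms by (intro polyfun.var) auto
  ultimately have "\<forall>y :: nat \<times> nat \<Rightarrow> real. y (i, j) = 0"
    using bspec[OF generic_point_if_generic[OF assms(1), unfolded generic_point_def]] by fastforce
  from spec[OF this, of "\<lambda>_. 1"] show False by simp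
qed

lemma generic_point_eliminated:
  assumes "generic n \<alpha>" "w \<in> {1..n}" "X \<subseteq> {1..n} - {w}"
  shows "generic_point ({1..n - 1} \<times> X) (\<lambda>(i, j). \<alpha> 1 w * \<alpha> (Suc i) j - \<alpha> (Suc i) w * \<alpha> 1 j)"
proof -
  define G :: "nat \<times> nat \<Rightarrow> (nat \<times> nat \<Rightarrow> real) \<Rightarrow> real"
    where "G k x = x (1, w) * x (Suc (fst k), snd k) - x (Suc (fst k), w) * x (1, snd k)" for k x
  have "generic_point ({1..n - 1} \<times> X) (\<lambda>k. G k (\<lambda>(i, j). \<alpha> i j))"
  proof (rule generic_point_compose[OF generic_point_if_generic[OF assms(1)]])
    fix k assume "k \<in> {1..n - 1} \<times> X"
    then have "Suc (fst k) \<in> {1..n}" "snd k \<in> {1..n}" "1 \<in> {1..n}"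
      using assms(2,3) by auto
    then show "G k \<in> polyfun ({1..n} \<times> {1..n})"
      unfolding G_def using assms(2) by (intro polyfun_diff polyfun.mult polyfun.var) auto
  next
    fix y :: "nat \<times> nat \<Rightarrow> real"
    \<comment> \<open>With 1 at \<open>(1, w)\<close> and 0 in the rest of column \<open>w\<close>,
      the elimination leaves the rows from 2 on unchanged; \<open>i - 1\<close> undoes their shift.
      The other entries of row 1 are multiplied by zero.\<close>
    define z where "z = (\<lambda>(i, j). if j = w then (if i = 1 then 1 else 0) else y (i - 1, j))"
    have "G k z = y k" if "k \<in> {1..n - 1} \<times> X" for k
      using that assms(3) by (auto simp: G_def z_def)
    then show "\<exists>z. \<forall>k\<in>{1..n - 1} \<times> X. G k z = y k" by blast
  qed
  then show ?thesis by (simp add: G_def case_prod_beta')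
qed

theorem theorem5p3:
  fixes K :: "'a set set" and v :: 'a
    and n m :: nat and \<alpha> \<beta> :: "nat \<Rightarrow> nat \<Rightarrow> real" and \<phi> \<psi> :: "'a \<Rightarrow> nat"
  assumes "simplicial_complex K"
    and "near_cone v K"
    and "generic n \<alpha>" and "labelling n \<phi> K"
    and "generic m \<beta>" and "labelling m \<psi> (link v K)"
  shows "algebraic_shift n \<alpha> \<phi> K =
    {{1} \<union> (\<lambda>t. t + 1) ` T | T. T \<in> algebraic_shift m \<beta> \<psi> (link v K)}
      \<union> {S \<in> algebraic_shift n \<alpha> \<phi> K. 1 \<notin> S}"
proof -
  let ?V = "vertices (link v K)"
  define L where "L = (`) \<phi> ` K"
  define w where "w = \<phi> v"
  define X where "X = \<phi> ` ?V"
  \<comment> \<open>Translates the label of a link vertex under \<open>\<phi>\<close> into its label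
    under \<open>\<psi>\<close>.\<close>
  define \<theta> where "\<theta> x = \<psi> (the_inv_into ?V \<phi> x)" for x
  let ?\<gamma> = "\<lambda>i j. \<alpha> 1 w * \<alpha> (Suc i) j - \<alpha> (Suc i) w * \<alpha> 1 j"
  have v: "v \<in> vertices K" using assms(2) by (simp add: near_cone_def)
  have \<phi>: "inj_on \<phi> (vertices K)" "\<phi> ` vertices K \<subseteq> {1..n}"
    and \<psi>: "inj_on \<psi> ?V" "\<psi> ` ?V \<subseteq> {1..m}"
    using assms(4,6) by (auto simp: labelling_def)
  have V: "?V \<subseteq> vertices K - {v}" "link v K \<subseteq> Pow ?V"
    using vertices_link_subset[OF assms(1)] by auto
  have \<phi>V: "inj_on \<phi> ?V" using \<phi>(1) V(1) by (auto intro: inj_on_subset)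
  have w: "w \<in> {1..n}" using v \<phi>(2) by (auto simp: w_def)
  then have n: "n \<ge> 1" by simp
  have L: "simplicial_complex L" "near_cone w L"
    using assms(1,2) \<phi>(1) by (simp_all add: L_def w_def simplicial_complex_image near_cone_image)
  have Ln: "L \<subseteq> Pow {1..n}"
    using simplicial_complex_subset_vertices[OF assms(1)] \<phi>(2) by (auto simp: L_def)
  have link: "link w L = (`) \<phi> ` link v K"
    unfolding L_def w_def by (rule link_image[OF assms(1) v \<phi>(1)])
  have X: "X \<subseteq> {1..n} - {w}"
    using V(1) v \<phi> unfolding X_def w_def by (auto dest: inj_onD)
  have finX: "finite X" using X by (rule finite_subset) simp
  have linkX: "link w L \<subseteq> Pow X" unfolding link X_def using V(2) by auto
  have cardX: "card X = card ?V" unfolding X_def using \<phi>V by (rule card_image)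
  have \<theta>\<phi>: "\<theta> (\<phi> u) = \<psi> u" if "u \<in> ?V" for u
    using that \<phi>V by (simp add: \<theta>_def the_inv_into_f_f)
  have \<theta>: "inj_on \<theta> X" "\<theta> ` X = \<psi> ` ?V"
    using \<psi>(1) \<phi>V \<theta>\<phi> by (auto simp: X_def inj_on_def image_image)
  have \<theta>link: "(`) \<theta> ` link w L = (`) \<psi> ` link v K"
  proof -
    have "(\<lambda>u. \<theta> (\<phi> u)) ` W = \<psi> ` W" if "W \<in> link v K" for W
      using that V(2) \<theta>\<phi> by (intro image_cong) auto
    then show ?thesis unfolding link image_image by (rule image_cong[OF refl])
  qed
  \<comment> \<open>As \<open>w\<close> is not a label of a link vertex, the \<open>n - 1\<close>
    eliminated rows are at least as many as the vertices of the link.\<close>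
  have "card X \<le> card ({1..n} - {w})" by (intro card_mono X) simp
  then have card1: "card X \<le> n - 1" using w by simp
  have "card (\<psi> ` ?V) \<le> card {1..m}" by (intro card_mono \<psi>(2)) simp
  then have card2: "card X \<le> m" using \<psi>(1) cardX by (simp add: card_image)
  \<comment> \<open>Reading columns through the injective \<open>\<theta>\<close> only selects and
    renames entries of \<open>\<beta>\<close>, so all values are still attained.\<close>
  have \<beta>: "generic_point ({1..m} \<times> X) (\<lambda>(i, j). \<beta> i (\<theta> j))"
  proof -
    have "generic_point ({1..m} \<times> X) (\<lambda>k. (\<lambda>(i, j). \<beta> i j) (fst k, \<theta> (snd k)))"
    proof (rule generic_point_compose[OF generic_point_if_generic[OF assms(5)]])
      fix k assume "k \<in> {1..m} \<times> X"
      moreover have "\<theta> ` X \<subseteq> {1..m}" using \<theta>(2) \<psi>(2) by simp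
      ultimately show "(\<lambda>x. x (fst k, \<theta> (snd k))) \<in> polyfun ({1..m} \<times> {1..m})"
        by (intro polyfun.var) (auto simp: image_subset_iff)
    next
      fix y :: "nat \<times> nat \<Rightarrow> real"
      show "\<exists>z. \<forall>k\<in>{1..m} \<times> X. z (fst k, \<theta> (snd k)) = y k"
        using \<theta>(1) by (intro exI[of _ "\<lambda>(i, j). y (i, the_inv_into X \<theta> j)"])
          (auto simp: the_inv_into_f_f)
    qed
    then show ?thesis by (simp add: case_prod_beta')
  qed
  have "algebraic_shift m \<beta> \<psi> (link v K) = shift_rows m (row_vec {1..m} \<beta>) ((`) \<psi> ` link v K)"
    unfolding algebraic_shift_def using assms(1) v
    by (intro shift_labelled_eq_shift_rows simplicial_complex_image simplicial_complex_link)
  also have "\<dots> = shift_rows m (row_vec (\<theta> ` X) \<beta>) ((`) \<theta> ` link w L)"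
    unfolding \<theta>link \<theta>(2)
  proof (rule shift_rows_restrict_columns)
    show "(`) \<psi> ` link v K \<subseteq> Pow (\<psi> ` ?V)" using V(2) by blast
  qed (use \<psi>(2) in simp_all)
  \<comment> \<open>Matrix, number of rows and labelling are exchanged at once: both matrices are
    generic on the columns of the link vertices.\<close>
  also have "\<dots> = shift_rows (n - 1) (row_vec X ?\<gamma>) (link w L)"
    using generic_point_eliminated[OF assms(3) w X] \<beta>
    by (intro shift_rows_independent_of_choices[symmetric] finX linkX \<theta>(1) card1 card2)
  also have "\<dots> = shift_rows (n - 1) (row_vec ({1..n} - {w}) ?\<gamma>) (link w L)"
    using X linkX by (intro shift_rows_restrict_columns[symmetric]) auto
  finally have link_shift: "algebraic_shift m \<beta> \<psi> (link v K) =
    shift_rows (n - 1) (row_vec ({1..n} - {w}) ?\<gamma>) (link w L)" .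
  have K_shift: "algebraic_shift n \<alpha> \<phi> K = shift_rows n (row_vec {1..n} \<alpha>) L"
    unfolding algebraic_shift_def L_def[symmetric] by (rule shift_labelled_eq_shift_rows[OF L(1)])
  have "\<alpha> 1 w \<noteq> 0" using assms(3) n w by (intro generic_nonzero) auto
  then have iff: "insert 1 (Suc ` T) \<in> algebraic_shift n \<alpha> \<phi> K \<longleftrightarrow> T \<in> algebraic_shift m \<beta> \<psi> (link v K)"
    if "T \<subseteq> {1..n - 1}" for T
    unfolding K_shift link_shift using that n w
    by (intro insert_1_in_shift_rows_iff[OF L(1) Ln L(2)])
  have "S \<in> {{1} \<union> (\<lambda>t. t + 1) ` T | T. T \<in> algebraic_shift m \<beta> \<psi> (link v K)} \<longleftrightarrow>
      S \<in> algebraic_shift n \<alpha> \<phi> K" if "1 \<in> S" for S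
  proof
    assume "S \<in> {{1} \<union> (\<lambda>t. t + 1) ` T | T. T \<in> algebraic_shift m \<beta> \<psi> (link v K)}"
    then obtain T where T: "S = insert 1 (Suc ` T)" "T \<in> algebraic_shift m \<beta> \<psi> (link v K)" by auto
    then have "T \<subseteq> {1..n - 1}" by (simp add: link_shift shift_rows_def)
    then show "S \<in> algebraic_shift n \<alpha> \<phi> K" using T iff by simp
  next
    assume S: "S \<in> algebraic_shift n \<alpha> \<phi> K"
    \<comment> \<open>The bound excludes \<open>t = 0\<close>, which would come from the element 1
      of \<open>S\<close>.\<close>
    define T where "T = {t. Suc t \<in> S \<and> t \<ge> 1}"
    have Sn: "S \<subseteq> {1..n}" using S by (simp add: K_shift shift_rows_def)
    have ST: "S = insert 1 (Suc ` T)"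
    proof (intro equalityI subsetI)
      fix x assume x: "x \<in> S"
      then have "x \<ge> 1" using Sn by auto
      then show "x \<in> insert 1 (Suc ` T)"
        using x by (cases "x = 1") (auto simp: T_def intro!: image_eqI[of _ _ "x - 1"])
    qed (use that in \<open>auto simp: T_def\<close>)
    have "T \<subseteq> {1..n - 1}" using Sn by (auto simp: T_def)
    then have "T \<in> algebraic_shift m \<beta> \<psi> (link v K)" using iff[of T] S ST by simp
    then show "S \<in> {{1} \<union> (\<lambda>t. t + 1) ` T | T. T \<in> algebraic_shift m \<beta> \<psi> (link v K)}"
      using ST by auto
  qed
  then show ?thesis by auto
qed

end
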